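(* Let $\mathcal A$ be a gargantuan (weighted) species of structures that can be represented as $\mathcal A=\mathcal E\circ\mathcal B$ for some (weighted) species of structures $\mathcal B$, where $\mathcal E$ is the species of sets. Assume that $m,n\in\mathbb Z_{\ge 0}$, and $s\in\mathcal A$ is a random $\mathcal A$-structure on $[n]$. In this case, $$\mathbb P\big(s\in\mathcal B^{\{m\}}\big)\approx\sum_{k\ge 0}\mathfrak d_{k,m}\cdot\binom nk\cdot\frac{\mathfrak a_{n-k}}{\mathfrak a_n},$$ where $\mathfrak a_n$ and $\mathfrak d_{n,m}$ are the total weights on the set $[n]$ of the species of structures $\mathcal A$ and $\mathcal D(m)=\mathcal B^{\{m-1\}}\cdot(\mathcal E^{-1}\circ\mathcal B)$, respectively.
   Context: A species of structures $F$ assigns to each finite set $U$ a finite set $F[U]$ of structures and to each bijection $\sigma:U\to V$ a map $F[\sigma]:F[U]\to F[V]$, functorially ($F[\tau\circ\sigma]=F[\tau]\circ F[\sigma]$, $F[\mathrm{Id}_U]=\mathrm{Id}_{F[U]}$). In a weighted species every structure $s$ carries a weight $w(s)$, taken in a ring of formal power series with coefficients in an integral domain ($\mathbb Z$ or $\mathbb R$), preserved by transport, and $F[U]$ is finite or summable. An unweighted species has all weights $1$. Write $[n]=\{1,\dots,n\}$, $[0]=\emptyset$, $F[n]=F[[n]]$. The total weight of $F$ on $[n]$ is $|F[n]|_w=\sum_{s\in F[n]}w(s)$. When all weights are positive, $F[n]$ is endowed with the discrete probability in which a structure $s$ appears with probability $w(s)/|F[n]|_w$ (uniform probability if the species is unweighted);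 $\mathbb P(s\in\cdot)$ denotes the resulting sequence of probabilities indexed by $n$ (for those $n$ with $F[n]$ nonempty). Equality of species means isomorphism (natural and weight-preserving). $\mathcal E$ is the species of sets ($\mathcal E[U]=\{U\}$), $\mathcal E_m$ is its restriction to sets of cardinality $m$, and $\mathcal E_+$ is its restriction to nonempty sets. For $\mathcal B$ with $\mathcal B[\emptyset]=\emptyset$, an $(F\circ\mathcal B)$-structure on $U$ consists of a partition $\pi$ of $U$, an $F$-structure on the set $\pi$, and a $\mathcal B$-structure on each block of $\pi$; its weight is the product of the weights of its components. Put $\mathcal B^{\{m\}}=\mathcal E_m\circ\mathcal B$, the subspecies of $\mathcal A=\mathcal E\circ\mathcal B$ whose structures have exactly $m$ connected components ($\mathcal B$-structures being the connected ones). The product $F\cdot G$ is the species of ordered pairs (an $F$-structure on $U_1$, a $G$-structure on $U_2$) with $U_1\sqcup U_2=U$, the weight being the product of weights. Virtual species are formal differences of species (the ring extension of the semiring of species under sum and product, to which composition also extends); total weights extend by linearity. $\mathcal E^{-1}=\sum_{k\ge0}(-1)^k(\mathcal E_+)^k$ is the multiplicative inverse of $\mathcal E$ among virtual species. A sequence $(a_n)$ is gargantuan if (i) $a_{n-1}/a_n\to0$ as $n\to\infty$ and (ii) for each $r\in\mathbb Z_{\ge0}$, $\sum_{k=r}^{n-r}|a_ka_{n-k}|=O(a_{n-r})$. A (virtual, weighted) species $F$ is gargantuan if the sequence $a_n=(\text{total weight of }F\text{ on }[n])/n!$ is gargantuan; in particular it is assumed that $a_n\neq0$ for almost all $n\in\mathbb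 Z_{\ge0}$. Notation $\approx$: for a sequence $(x_n)$ and an integer $\ell$, $x_n\approx\sum_{k\ge \ell}f_k(n)$ means that for every integer $r\ge \ell$, $x_n=\sum_{k=\ell}^{r}f_k(n)+O\big(f_{r+1}(n)\big)$, and for every integer $k\ge \ell$, $f_{k+1}(n)=o\big(f_k(n)\big)$, as $n\to\infty$. Here $f_k(n)=\mathfrak d_{k,m}\binom nk\frac{\mathfrak a_{n-k}}{\mathfrak a_n}$, $k\ge0$.
   Formalization: The relation ≈ is read with vanishing terms skipped: the error O(f_{r+1}) and f_{k+1}=o(f_k) refer to the next term that is not eventually zero; taken literally the claim fails, e.g. for graphs with m=2, where d_{0,2}=0 but d_{1,2}=1. *)

theory Defs
  imports "HOL-Probability.Probability" "HOL-Library.Landau_Symbols" "HOL-Library.Disjoint_Sets"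
begin

text \<open>
  A species on the finite subsets of a label type.  A bijection out of U is represented by a
  function that is injective on U, with target its image; so the transport along a function
  sends structures on U to structures on the image of U.  Weights are real numbers.
\<close>

record ('u, 's) species =
  structures :: "'u set \<Rightarrow> 's set"
  transport :: "'u set \<Rightarrow> ('u \<Rightarrow> 'u) \<Rightarrow> 's \<Rightarrow> 's"
  weight :: "'u set \<Rightarrow> 's \<Rightarrow> real"

text \<open>
  The summability condition covers both the finite case (where it is automatic) and the summable
  one.  The fourth condition says that transport depends only on the bijection, not on the values
  of the representing function outside U.
\<close>

definition is_species :: "('u, 's) species \<Rightarrow> bool" where
  "is_species F \<longleftrightarrow>
     (\<forall>U. finite U \<longrightarrow> weight F U summable_on structures F U) \<and>
     (\<forall>U \<sigma> s. finite U \<longrightarrow> inj_on \<sigma> U \<longrightarrow> s \<in> structures F U \<longrightarrow>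
        transport F U \<sigma> s \<in> structures F (\<sigma> ` U) \<and>
        weight F (\<sigma> ` U) (transport F U \<sigma> s) = weight F U s) \<and>
     (\<forall>U s. finite U \<longrightarrow> s \<in> structures F U \<longrightarrow> transport F U id s = s) \<and>
     (\<forall>U \<sigma> \<tau> s. finite U \<longrightarrow> inj_on \<sigma> U \<longrightarrow> (\<forall>u\<in>U. \<sigma> u = \<tau> u) \<longrightarrow> s \<in> structures F U \<longrightarrow>
        transport F U \<sigma> s = transport F U \<tau> s) \<and>
     (\<forall>U \<sigma> \<tau> s. finite U \<longrightarrow> inj_on \<sigma> U \<longrightarrow> inj_on \<tau> (\<sigma> ` U) \<longrightarrow> s \<in> structures F U \<longrightarrow>
        transport F U (\<tau> \<circ> \<sigma>) s = transport F (\<sigma> ` U) \<tau> (transport F U \<sigma> s))"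

definition species_iso ::
    "('u set \<Rightarrow> 's \<Rightarrow> 't) \<Rightarrow> ('u, 's) species \<Rightarrow> ('u, 't) species \<Rightarrow> bool" where
  "species_iso \<phi> F G \<longleftrightarrow>
     (\<forall>U. finite U \<longrightarrow> bij_betw (\<phi> U) (structures F U) (structures G U)) \<and>
     (\<forall>U s. finite U \<longrightarrow> s \<in> structures F U \<longrightarrow> weight G U (\<phi> U s) = weight F U s) \<and>
     (\<forall>U \<sigma> s. finite U \<longrightarrow> inj_on \<sigma> U \<longrightarrow> s \<in> structures F U \<longrightarrow>
        \<phi> (\<sigma> ` U) (transport F U \<sigma> s) = transport G U \<sigma> (\<phi> U s))"

definition total_weight :: "('u, 's) species \<Rightarrow> 'u set \<Rightarrow> real" where
  "total_weight F U = (\<Sum>\<^sub>\<infinity>s\<in>structures F U. weight F U s)"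

definition positive_weights :: "('u, 's) species \<Rightarrow> bool" where
  "positive_weights F \<longleftrightarrow> (\<forall>U s. finite U \<longrightarrow> s \<in> structures F U \<longrightarrow> weight F U s > 0)"

text \<open>Only meaningful when F has positive weights and at least one structure on U.\<close>

definition random_structure :: "('u, 's) species \<Rightarrow> 'u set \<Rightarrow> 's pmf" where
  "random_structure F U =
     embed_pmf (\<lambda>s. if s \<in> structures F U then weight F U s / total_weight F U else 0)"

definition set_species :: "('u, 'u set) species" where
  "set_species = \<lparr>structures = (\<lambda>U. {U}), transport = (\<lambda>U \<sigma> s. \<sigma> ` s), weight = (\<lambda>U s. 1)\<rparr>"

definition restrict_species :: "('u set \<Rightarrow> bool) \<Rightarrow> ('u, 's) species \<Rightarrow> ('u, 's) species" where
  "restrict_species P F =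
     \<lparr>structures = (\<lambda>U. if P U then structures F U else {}),
      transport = transport F, weight = weight F\<rparr>"

text \<open>The index is an integer so that index -1 makes sense; it gives the empty species.\<close>

definition sets_of_card :: "int \<Rightarrow> ('u, 'u set) species" where
  "sets_of_card m = restrict_species (\<lambda>U. int (card U) = m) set_species"

definition nonempty_sets :: "('u, 'u set) species" where
  "nonempty_sets = restrict_species (\<lambda>U. U \<noteq> {}) set_species"

text \<open>
  A structure of the composition is a partition, a structure of F on the set of its blocks, and
  an (extensional) family of structures of B on the blocks.  In the transported family, the block
  Y of the image partition is the image of the block of those u in U with \<open>\<sigma> u \<in> Y\<close>.
\<close>

definition compose_species ::
    "('u set, 'f) species \<Rightarrow> ('u, 'b) species \<Rightarrow>
     ('u, 'u set set \<times> 'f \<times> ('u set \<Rightarrow> 'b)) species" where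
  "compose_species F B =
     \<lparr>structures = (\<lambda>U. {(\<pi>, t, f). partition_on U \<pi> \<and> t \<in> structures F \<pi> \<and>
                                   f \<in> (\<Pi>\<^sub>E X\<in>\<pi>. structures B X)}),
      transport = (\<lambda>U \<sigma> (\<pi>, t, f).
        ((`) \<sigma> ` \<pi>, transport F \<pi> ((`) \<sigma>) t,
         (\<lambda>Y\<in>(`) \<sigma> ` \<pi>. let X = {u \<in> U. \<sigma> u \<in> Y} in transport B X \<sigma> (f X)))),
      weight = (\<lambda>U (\<pi>, t, f). weight F \<pi> t * (\<Prod>X\<in>\<pi>. weight B X (f X)))\<rparr>"

definition product_species ::
    "('u, 's) species \<Rightarrow> ('u, 't) species \<Rightarrow> ('u, ('u set \<times> 's) \<times> ('u set \<times> 't)) species" where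
  "product_species F G =
     \<lparr>structures = (\<lambda>U. {((V, s), (W, t)). V \<inter> W = {} \<and> V \<union> W = U \<and>
                                          s \<in> structures F V \<and> t \<in> structures G W}),
      transport = (\<lambda>U \<sigma> ((V, s), (W, t)).
        ((\<sigma> ` V, transport F V \<sigma> s), (\<sigma> ` W, transport G W \<sigma> t))),
      weight = (\<lambda>U ((V, s), (W, t)). weight F V s * weight G W t)\<rparr>"

text \<open>
  The k-fold product, with the nested pairs flattened to a list of length k (the type of an
  iterated binary product would depend on k).
\<close>

definition power_species :: "('u, 's) species \<Rightarrow> nat \<Rightarrow> ('u, ('u set \<times> 's) list) species" where
  "power_species F k =
     \<lparr>structures = (\<lambda>U. {xs. length xs = k \<and> (\<Union>i<k. fst (xs ! i)) = U \<and>
                            (\<forall>i<k. \<forall>j<k. i \<noteq> j \<longrightarrow> fst (xs ! i) \<inter> fst (xs ! j) = {}) \<and>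
                            (\<forall>i<k. snd (xs ! i) \<in> structures F (fst (xs ! i)))}),
      transport = (\<lambda>U \<sigma>. map (\<lambda>(V, s). (\<sigma> ` V, transport F V \<sigma> s))),
      weight = (\<lambda>U xs. \<Prod>i<k. weight F (fst (xs ! i)) (snd (xs ! i)))\<rparr>"

definition sum_species :: "'i set \<Rightarrow> ('i \<Rightarrow> ('u, 's) species) \<Rightarrow> ('u, 'i \<times> 's) species" where
  "sum_species I F =
     \<lparr>structures = (\<lambda>U. SIGMA i:I. structures (F i) U),
      transport = (\<lambda>U \<sigma> (i, s). (i, transport (F i) U \<sigma> s)),
      weight = (\<lambda>U (i, s). weight (F i) U s)\<rparr>"

text \<open>The pair (P, N) represents the formal difference P - N.\<close>

type_synonym ('u, 'p, 'n) virtual_species = "('u, 'p) species \<times> ('u, 'n) species"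

definition virtual_total_weight :: "('u, 'p, 'n) virtual_species \<Rightarrow> 'u set \<Rightarrow> real" where
  "virtual_total_weight D U = total_weight (fst D) U - total_weight (snd D) U"

definition virtual_compose ::
    "('u set, 'p, 'n) virtual_species \<Rightarrow> ('u, 'b) species \<Rightarrow>
     ('u, 'u set set \<times> 'p \<times> ('u set \<Rightarrow> 'b), 'u set set \<times> 'n \<times> ('u set \<Rightarrow> 'b)) virtual_species" where
  "virtual_compose D B = (compose_species (fst D) B, compose_species (snd D) B)"

definition virtual_product ::
    "('u, 's) species \<Rightarrow> ('u, 'p, 'n) virtual_species \<Rightarrow>
     ('u, ('u set \<times> 's) \<times> ('u set \<times> 'p), ('u set \<times> 's) \<times> ('u set \<times> 'n)) virtual_species" where
  "virtual_product F D = (product_species F (fst D), product_species F (snd D))"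

text \<open>
  The alternating sum of the powers of the species of nonempty sets: the even powers form the
  positive part and the odd powers the negative part.
\<close>

definition inverse_set_species ::
    "('u, nat \<times> ('u set \<times> 'u set) list, nat \<times> ('u set \<times> 'u set) list) virtual_species" where
  "inverse_set_species =
     (sum_species {k. even k} (power_species nonempty_sets),
      sum_species {k. odd k} (power_species nonempty_sets))"

definition component_species ::
    "('u, 'b) species \<Rightarrow> int \<Rightarrow> ('u, 'u set set \<times> 'u set set \<times> ('u set \<Rightarrow> 'b)) species" where
  "component_species B m = compose_species (sets_of_card m) B"

definition coefficient_species where
  "coefficient_species B m =
     virtual_product (component_species B (m - 1)) (virtual_compose inverse_set_species B)"

definition gargantuan :: "(nat \<Rightarrow> real) \<Rightarrow> bool" where
  "gargantuan a \<longleftrightarrow>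
     (\<forall>\<^sub>F n in sequentially. a n \<noteq> 0) \<and>
     (\<lambda>n. a (n - 1) / a n) \<longlonglongrightarrow> 0 \<and>
     (\<forall>r. (\<lambda>n. \<Sum>k=r..n - r. \<bar>a k * a (n - k)\<bar>) \<in> O(\<lambda>n. a (n - r)))"

definition gargantuan_species :: "(nat, 's) species \<Rightarrow> bool" where
  "gargantuan_species F \<longleftrightarrow> gargantuan (\<lambda>n. total_weight F {1..n} / fact n)"

text \<open>
  Asymptotic expansions are read with the usual convention that vanishing terms are skipped: the
  term following \<open>f r\<close> is the next one that is not eventually zero.  If there is none, it is the
  zero sequence, so that the expansion up to \<open>f r\<close> is eventually exact.  Taken literally, with
  \<open>f (Suc r)\<close> in place of the next nonvanishing term, the notion would exclude expansions with
  isolated zero coefficients, such as the one for the probability that a graph is connected.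
\<close>

definition vanishing :: "(nat \<Rightarrow> real) \<Rightarrow> bool" where
  "vanishing g \<longleftrightarrow> (\<forall>\<^sub>F n in sequentially. g n = 0)"

definition next_term :: "(nat \<Rightarrow> nat \<Rightarrow> real) \<Rightarrow> nat \<Rightarrow> nat \<Rightarrow> real" where
  "next_term f r =
     (if \<exists>j>r. \<not> vanishing (f j) then f (LEAST j. j > r \<and> \<not> vanishing (f j)) else (\<lambda>n. 0))"

definition asymptotic_expansion :: "(nat \<Rightarrow> real) \<Rightarrow> nat \<Rightarrow> (nat \<Rightarrow> nat \<Rightarrow> real) \<Rightarrow> bool" where
  "asymptotic_expansion x l f \<longleftrightarrow>
     (\<forall>r\<ge>l. (\<lambda>n. x n - (\<Sum>k=l..r. f k n)) \<in> O(next_term f r)) \<and>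
     (\<forall>k\<ge>l. \<not> vanishing (f k) \<longrightarrow> next_term f k \<in> o(f k))"

text \<open>When no term vanishes, this is the literal definition.\<close>

lemma asymptotic_expansion_nonvanishing:
  assumes "\<And>k. k \<ge> l \<Longrightarrow> \<not> vanishing (f k)"
  shows "asymptotic_expansion x l f \<longleftrightarrow>
     (\<forall>r\<ge>l. (\<lambda>n. x n - (\<Sum>k=l..r. f k n)) \<in> O(f (Suc r))) \<and>
     (\<forall>k\<ge>l. f (Suc k) \<in> o(f k))"
proof -
  have nxt: "next_term f r = f (Suc r)" if "r \<ge> l" for r
  proof -
    have nv: "\<not> vanishing (f (Suc r))"
      using assms that by simp
    then have "(LEAST j. j > r \<and> \<not> vanishing (f j)) = Suc r"
      by (intro Least_equality) auto
    with nv show ?thesis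
      unfolding next_term_def by (metis lessI)
  qed
  with assms show ?thesis
    unfolding asymptotic_expansion_def by simp
qed

end

theory Submission
  imports Defs "HOL-Computational_Algebra.Formal_Power_Series"
begin

text \<open>
  Let \<open>a\<close> and \<open>b\<close> be the exponential generating functions of A and B, so that \<open>a = exp b\<close>, and let
  \<open>e = exp (- b)\<close>.  The structures with m components have generating function \<open>b ^ m / m!\<close>, and
  \<open>D(m)\<close> has its formal derivative with respect to \<open>a\<close>, namely \<open>b ^ (m - 1) / (m - 1)! * e\<close>.
  Say that F expands with D if, for every r, the coefficient of F at n is the sum of
  \<open>D $ k * a $ (n - k)\<close> over \<open>k \<le> r\<close> up to an error \<open>O(a $ (n - r - 1))\<close>.  In the convolution of two
  sequences that are \<open>O(a)\<close> only the terms near both ends matter.  Hence D depends on F by the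
  product rule, and the identity \<open>n a\<^sub>n = \<Sum> k b\<^sub>k a\<^sub>n\<^sub>-\<^sub>k\<close> shows that \<open>b\<close> expands with \<open>e\<close>;
  the result for \<open>b ^ m / m!\<close> follows by induction on m.

  If all terms beyond some index vanished, the expansion would have to be eventually exact.  For
  positive m this does not occur: if \<open>D(m)\<close> were a polynomial, then \<open>b ^ (m - 1) / (m - 1)!\<close>, being
  \<open>D(m) * a\<close>, would expand with \<open>D(m)\<close> as well as with \<open>D(m - 1)\<close>, whereas the two differ.
\<close>

unbundle no vec_syntax
unbundle fps_syntax

section \<open>Expansions over gargantuan sequences\<close>

lemma gargantuan_shift_smallo:
  assumes "gargantuan a" "i < j"
  shows "(\<lambda>n. a (n - j)) \<in> o(\<lambda>n. a (n - i))"
proof -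
  have step: "(\<lambda>n. a (n - 1)) \<in> o(a)"
    using assms(1) unfolding gargantuan_def by (intro smalloI_tendsto) auto
  have "(\<lambda>n. a (n - Suc i)) \<in> o(\<lambda>n. a (n - i))" for i
    using landau_o.small.compose[OF step filterlim_minus_const_nat_at_top[of i]] by simp
  with assms(2) show ?thesis
  proof (induction j rule: less_Suc_induct)
    case (2 i j k)
    then show ?case by (blast intro: landau_o.small_trans)
  qed blast
qed

lemma gargantuan_shift_bigo:
  assumes "gargantuan a" "i \<le> j"
  shows "(\<lambda>n. a (n - j)) \<in> O(\<lambda>n. a (n - i))"
  using gargantuan_shift_smallo[OF assms(1), of i j] assms(2)
  by (cases "i = j") (auto intro: landau_o.small_imp_big)

text \<open>A bound by a later shift would make the sequence little-o of itself, hence eventually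
  zero. This separation of scales underlies the uniqueness of expansions.\<close>

lemma gargantuan_shift_not_bigo:
  assumes "gargantuan a" "i < j"
  shows "(\<lambda>n. a (n - i)) \<notin> O(\<lambda>n. a (n - j))"
proof
  assume "(\<lambda>n. a (n - i)) \<in> O(\<lambda>n. a (n - j))"
  then have "(\<lambda>n. a (n - i)) \<in> o(\<lambda>n. a (n - i))"
    using gargantuan_shift_smallo[OF assms] by (rule landau_o.big_small_trans)
  then have "\<forall>\<^sub>F n in sequentially. a (n - i) = 0"
    by (simp add: landau_o.small_refl_iff)
  moreover have "\<forall>\<^sub>F n in sequentially. a (n - i) \<noteq> 0"
    using assms(1) filterlim_minus_const_nat_at_top[of i]
    unfolding gargantuan_def filterlim_iff by blast
  ultimately have "\<forall>\<^sub>F n :: nat in sequentially. False"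
    by eventually_elim simp
  then show False by simp
qed

text \<open>Away from both ends the sum is dominated by that of
  \<open>\<bar>a k * a (n - k)\<bar>\<close>, which the last clause of \<open>gargantuan\<close>
  controls. The weights are constantly 1 for products of series and \<open>k / n\<close> for the
  logarithm.\<close>

lemma gargantuan_weighted_convolution:
  fixes w :: "nat \<Rightarrow> nat \<Rightarrow> real"
  assumes a: "gargantuan a" and f: "f \<in> O(a)" and g: "g \<in> O(a)"
    and w: "\<And>n k. k \<le> n \<Longrightarrow> \<bar>w n k\<bar> \<le> 1"
  shows "(\<lambda>n. (\<Sum>k\<le>n. w n k * f k * g (n - k)) -
           (\<Sum>k\<le>r. w n k * f k * g (n - k) + w n (n - k) * f (n - k) * g k))
         \<in> O(\<lambda>n. a (n - Suc r))"
proof -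
  obtain C where C: "C > 0" "\<forall>\<^sub>F n in sequentially. \<bar>f n\<bar> \<le> C * \<bar>a n\<bar>"
    using landau_o.bigE[OF f] by auto
  obtain D where D: "D > 0" "\<forall>\<^sub>F n in sequentially. \<bar>g n\<bar> \<le> D * \<bar>a n\<bar>"
    using landau_o.bigE[OF g] by auto
  obtain N where N: "\<And>n. n \<ge> N \<Longrightarrow> \<bar>f n\<bar> \<le> C * \<bar>a n\<bar>" "\<And>n. n \<ge> N \<Longrightarrow> \<bar>g n\<bar> \<le> D * \<bar>a n\<bar>"
    using eventually_conj[OF C(2) D(2)] unfolding eventually_sequentially by blast
  \<comment> \<open>The bounds by \<open>a\<close> hold only from \<open>N\<close> on, so the middle
    range keeps both \<open>k\<close> and \<open>n - k\<close> above \<open>N\<close>; the finitely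
    many indices between \<open>r\<close> and \<open>s\<close> are estimated one by one.\<close>
  define s where "s = max r N"
  define t where "t = (\<lambda>n k. w n k * f k * g (n - k))"
  define u where "u = (\<lambda>n k. w n (n - k) * f (n - k) * g k)"
  have shift: "(\<lambda>n. h (n - k)) \<in> O(\<lambda>n. a (n - k))" if "h \<in> O(a)" for h k
    using landau_o.big.compose[OF that filterlim_minus_const_nat_at_top[of k]] .
  have tk: "t' \<in> O(\<lambda>n. a (n - k))"
    if "\<And>n. n \<ge> k \<Longrightarrow> \<bar>t' n\<bar> \<le> \<bar>c * h (n - k)\<bar>" "h \<in> O(a)" for t' c h k
  proof -
    have "t' \<in> O(\<lambda>n. c * h (n - k))"
      using that(1) by (intro landau_o.big_mono eventually_sequentiallyI[of k]) auto
    also have "(\<lambda>n. c * h (n - k)) \<in> O(\<lambda>n. a (n - k))"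
      using shift[OF that(2)] by (cases "c = 0") auto
    finally show ?thesis .
  qed
  have wmul: "\<bar>w n k * x * y\<bar> \<le> \<bar>x * y\<bar>" if "k \<le> n" for n k x y
    using mult_right_mono[OF w[OF that], of "\<bar>x * y\<bar>"] by (simp add: abs_mult mult.assoc)
  have tu: "(\<lambda>n. t n k + u n k) \<in> O(\<lambda>n. a (n - k))" for k
  proof (rule sum_in_bigo)
    show "(\<lambda>n. t n k) \<in> O(\<lambda>n. a (n - k))"
      unfolding t_def by (rule tk[OF wmul g])
    show "(\<lambda>n. u n k) \<in> O(\<lambda>n. a (n - k))"
      unfolding u_def by (rule tk[OF _ f, of _ _ "g k"]) (metis diff_le_self mult.commute wmul)
  qed
  have edge: "(\<lambda>n. \<Sum>k\<in>{Suc r..s}. t n k + u n k) \<in> O(\<lambda>n. a (n - Suc r))"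
    by (rule big_sum_in_bigo, rule landau_o.big_trans[OF tu gargantuan_shift_bigo[OF a]]) simp
  have mid: "(\<lambda>n. \<Sum>k=Suc s..n - Suc s. t n k) \<in> O(\<lambda>n. a (n - Suc r))"
  proof -
    have "\<bar>\<Sum>k=Suc s..n - Suc s. t n k\<bar> \<le> C * D * \<bar>\<Sum>k=Suc s..n - Suc s. \<bar>a k * a (n - k)\<bar>\<bar>" for n
    proof -
      have "\<bar>\<Sum>k=Suc s..n - Suc s. t n k\<bar> \<le> (\<Sum>k=Suc s..n - Suc s. C * D * \<bar>a k * a (n - k)\<bar>)"
      proof (intro order.trans[OF sum_abs] sum_mono)
        fix k assume k: "k \<in> {Suc s..n - Suc s}"
        then have "\<bar>t n k\<bar> \<le> \<bar>f k * g (n - k)\<bar>"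
          unfolding t_def by (intro wmul) auto
        also have "\<dots> = \<bar>f k\<bar> * \<bar>g (n - k)\<bar>"
          by (rule abs_mult)
        also have "\<dots> \<le> (C * \<bar>a k\<bar>) * (D * \<bar>a (n - k)\<bar>)"
          using k C(1) by (intro mult_mono N) (auto simp: s_def)
        finally show "\<bar>t n k\<bar> \<le> C * D * \<bar>a k * a (n - k)\<bar>"
          by (simp add: abs_mult mult_ac)
      qed
      then show ?thesis
        by (simp add: sum_distrib_left sum_nonneg)
    qed
    then have "(\<lambda>n. \<Sum>k=Suc s..n - Suc s. t n k) \<in>
                 O(\<lambda>n. \<Sum>k=Suc s..n - Suc s. \<bar>a k * a (n - k)\<bar>)"
      by (intro landau_o.bigI[of "C * D"]) (use C D in auto)
    also have "(\<lambda>n. \<Sum>k=Suc s..n - Suc s. \<bar>a k * a (n - k)\<bar>) \<in> O(\<lambda>n. a (n - Suc s))"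
      using a unfolding gargantuan_def by blast
    also have "(\<lambda>n. a (n - Suc s)) \<in> O(\<lambda>n. a (n - Suc r))"
      by (intro gargantuan_shift_bigo a) (simp add: s_def)
    finally show ?thesis .
  qed
  \<comment> \<open>For \<open>n\<close> this large the two end ranges are disjoint, and reflecting
    \<open>k\<close> to \<open>n - k\<close> turns the upper one into the terms
    \<open>u\<close>.\<close>
  have split: "(\<Sum>k\<le>n. t n k) - (\<Sum>k\<le>r. t n k + u n k) =
      (\<Sum>k\<in>{Suc r..s}. t n k + u n k) + (\<Sum>k=Suc s..n - Suc s. t n k)"
    if n: "n \<ge> 2 * s + 2" for n
  proof -
    have dec: "{..n} = {..s} \<union> ({Suc s..n - Suc s} \<union> {n - s..n})" using n by auto
    have "(\<Sum>k\<le>n. t n k) = (\<Sum>k\<le>s. t n k) + ((\<Sum>k=Suc s..n - Suc s. t n k) + (\<Sum>k=n - s..n. t n k))"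
      unfolding dec using n by (subst sum.union_disjoint; force simp: sum.union_disjoint)+
    moreover have "(\<Sum>k=n - s..n. t n k) = (\<Sum>k\<le>s. u n k)"
      by (rule sum.reindex_bij_witness[of _ "\<lambda>k. n - k" "\<lambda>k. n - k"])
         (use n in \<open>auto simp: t_def u_def\<close>)
    moreover have "(\<Sum>k\<le>s. t n k + u n k) =
        (\<Sum>k\<le>r. t n k + u n k) + (\<Sum>k\<in>{Suc r..s}. t n k + u n k)"
    proof -
      have "{..s} = {..r} \<union> {Suc r..s}" by (auto simp: s_def)
      then show ?thesis by (simp add: sum.union_disjoint)
    qed
    ultimately show ?thesis by (simp add: sum.distrib)
  qed
  have "(\<lambda>n. (\<Sum>k\<in>{Suc r..s}. t n k + u n k) + (\<Sum>k=Suc s..n - Suc s. t n k))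
          \<in> O(\<lambda>n. a (n - Suc r))"
    using edge mid by (rule sum_in_bigo)
  then have "(\<lambda>n. (\<Sum>k\<le>n. t n k) - (\<Sum>k\<le>r. t n k + u n k)) \<in> O(\<lambda>n. a (n - Suc r))"
    by (subst landau_o.big.in_cong[OF eventually_sequentiallyI[of "2 * s + 2"]])
       (use split in auto)
  then show ?thesis by (simp add: t_def u_def)
qed


section \<open>Products and uniqueness of expansions\<close>

text \<open>Coefficients of exponential generating functions absorb the binomials. The error is
  measured by the shift \<open>Suc r\<close> even where \<open>D\<close> vanishes; zero coefficients
  are skipped only in \<open>asymptotic_expansion_of_expands\<close>.\<close>

definition expands :: "real fps \<Rightarrow> real fps \<Rightarrow> real fps \<Rightarrow> nat \<Rightarrow> bool" where
  "expands A F D r \<longleftrightarrow>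
     (\<lambda>n. F $ n - (\<Sum>k\<le>r. D $ k * A $ (n - k))) \<in> O(\<lambda>n. A $ (n - Suc r))"

lemma expands_imp_bigo:
  assumes a: "gargantuan (fps_nth A)" and "expands A F D 0"
  shows "fps_nth F \<in> O(fps_nth A)"
proof -
  have "(\<lambda>n. F $ n - D $ 0 * A $ n) \<in> O(\<lambda>n. A $ (n - Suc 0))"
    using assms(2) by (simp add: expands_def)
  also have "(\<lambda>n. A $ (n - Suc 0)) \<in> O(fps_nth A)"
    using gargantuan_shift_bigo[OF a, of 0 1] by simp
  finally have "(\<lambda>n. (F $ n - D $ 0 * A $ n) + D $ 0 * A $ n) \<in> O(fps_nth A)"
    by (rule sum_in_bigo) (cases "D $ 0 = 0"; simp)
  then show ?thesis by simp
qed

lemma expands_cmult: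
  assumes "expands A F D r"
  shows "expands A (fps_const c * F) (fps_const c * D) r"
proof -
  have "(\<lambda>n. c * (F $ n - (\<Sum>k\<le>r. D $ k * A $ (n - k)))) \<in> O(\<lambda>n. A $ (n - Suc r))"
    using assms unfolding expands_def by (cases "c = 0") auto
  then show ?thesis
    unfolding expands_def by (simp add: right_diff_distrib sum_distrib_left mult.assoc)
qed

text \<open>The shift by \<open>k\<close> raises the order of the error by \<open>k\<close>, so
  expanding \<open>G\<close> to order \<open>r - k\<close> suffices. Asking for this only where
  \<open>F $ k\<close> is nonzero lets a series without constant term get by with orders below
  \<open>r\<close>, as the induction in \<open>expands_log\<close> requires.\<close>

lemma expands_partial_convolution:
  assumes "\<And>k. k \<le> r \<Longrightarrow> F $ k \<noteq> 0 \<Longrightarrow> expands A G D (r - k)"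
  shows "(\<lambda>n. (\<Sum>k\<le>r. F $ k * G $ (n - k)) - (\<Sum>k\<le>r. (F * D) $ k * A $ (n - k)))
         \<in> O(\<lambda>n. A $ (n - Suc r))"
proof -
  have summand: "(\<lambda>n. F $ k * (G $ (n - k) - (\<Sum>i\<le>r - k. D $ i * A $ (n - k - i))))
      \<in> O(\<lambda>n. A $ (n - Suc r))" if k: "k \<le> r" for k
  proof (cases "F $ k = 0")
    case False
    have "(\<lambda>n. G $ (n - k) - (\<Sum>i\<le>r - k. D $ i * A $ (n - k - i))) \<in>
            O(\<lambda>n. A $ (n - k - Suc (r - k)))"
      using landau_o.big.compose[OF assms[OF k False, unfolded expands_def]
              filterlim_minus_const_nat_at_top[of k]] .
    moreover have "n - k - Suc (r - k) = n - Suc r" for n using k by simp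
    ultimately show ?thesis using False by simp
  qed simp
  have "(\<Sum>k\<le>r. (F * D) $ k * A $ (n - k)) =
      (\<Sum>k\<le>r. F $ k * (\<Sum>i\<le>r - k. D $ i * A $ (n - k - i)))" for n
  proof -
    have "(\<Sum>k\<le>r. (F * D) $ k * A $ (n - k)) =
        (\<Sum>(s, k)\<in>(SIGMA s:{..r}. {..s}). F $ k * D $ (s - k) * A $ (n - s))"
      by (simp add: fps_mult_nth sum_distrib_right sum.Sigma atLeast0AtMost)
    also have "\<dots> = (\<Sum>(k, i)\<in>(SIGMA k:{..r}. {..r - k}). F $ k * (D $ i * A $ (n - k - i)))"
      by (rule sum.reindex_bij_witness[of _ "\<lambda>(k, i). (k + i, k)" "\<lambda>(s, k). (k, s - k)"])
         (auto simp: mult.assoc)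
    also have "\<dots> = (\<Sum>k\<le>r. F $ k * (\<Sum>i\<le>r - k. D $ i * A $ (n - k - i)))"
      by (simp add: sum_distrib_left sum.Sigma)
    finally show ?thesis .
  qed
  then have "(\<Sum>k\<le>r. F $ k * G $ (n - k)) - (\<Sum>k\<le>r. (F * D) $ k * A $ (n - k)) =
      (\<Sum>k\<le>r. F $ k * (G $ (n - k) - (\<Sum>i\<le>r - k. D $ i * A $ (n - k - i))))" for n
    by (simp add: right_diff_distrib sum_subtractf)
  moreover have "(\<lambda>n. \<Sum>k\<le>r. F $ k * (G $ (n - k) - (\<Sum>i\<le>r - k. D $ i * A $ (n - k - i))))
      \<in> O(\<lambda>n. A $ (n - Suc r))"
    by (rule big_sum_in_bigo, rule summand) simp
  ultimately show ?thesis
    by (simp only:)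
qed

text \<open>The low coefficients of \<open>F\<close> meet the tail of \<open>G\<close> and
  contribute \<open>F * G'\<close>; the opposite end contributes \<open>G * F'\<close>.\<close>

lemma expands_mult:
  assumes a: "gargantuan (fps_nth A)"
    and F: "\<And>r. expands A F F' r" and G: "\<And>r. expands A G G' r"
  shows "expands A (F * G) (F * G' + G * F') r"
proof -
  have "(\<lambda>n. (\<Sum>k\<le>n. 1 * F $ k * G $ (n - k)) -
           (\<Sum>k\<le>r. 1 * F $ k * G $ (n - k) + 1 * F $ (n - k) * G $ k))
         \<in> O(\<lambda>n. A $ (n - Suc r))"
    using expands_imp_bigo[OF a F] expands_imp_bigo[OF a G]
    by (intro gargantuan_weighted_convolution a) auto
  \<comment> \<open>Adding the three errors cancels the truncated convolutions.\<close>
  from sum_in_bigo(1)[OF this sum_in_bigo(1)[OF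
        expands_partial_convolution[of r F, OF G] expands_partial_convolution[of r G, OF F]]]
  have "(\<lambda>n. (F * G) $ n - (\<Sum>k\<le>r. F $ k * G $ (n - k) + G $ k * F $ (n - k)) +
      ((\<Sum>k\<le>r. F $ k * G $ (n - k)) - (\<Sum>k\<le>r. (F * G') $ k * A $ (n - k)) +
       ((\<Sum>k\<le>r. G $ k * F $ (n - k)) - (\<Sum>k\<le>r. (G * F') $ k * A $ (n - k)))))
    \<in> O(\<lambda>n. A $ (n - Suc r))"
    unfolding fps_mult_nth[of F G] atLeast0AtMost mult_1_left
    by (simp only: mult.commute[of "F $ (_ - _)" "G $ _"])
  then show ?thesis
    unfolding expands_def by (simp only: sum.distrib distrib_right fps_add_nth) (simp add: algebra_simps)
qed

text \<open>In the difference of the two expansions, cut at the first index \<open>v\<close> where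
  they disagree, only a multiple of \<open>A $ (n - v)\<close> is left, and it would have to be of
  the order of \<open>A $ (n - Suc v)\<close>.\<close>

lemma expands_unique:
  assumes a: "gargantuan (fps_nth A)"
    and D: "\<And>r. expands A F D r" and D': "\<And>r. expands A F D' r"
  shows "D = D'"
proof (rule ccontr)
  assume "D \<noteq> D'"
  define C v where "C = D' - D" and "v = subdegree C"
  have "C \<noteq> 0"
    using \<open>D \<noteq> D'\<close> by (simp add: C_def)
  then have Cv: "C $ v \<noteq> 0"
    by (simp add: v_def)
  have "(\<lambda>n. \<Sum>k\<le>v. C $ k * A $ (n - k)) \<in> O(\<lambda>n. A $ (n - Suc v))"
    using sum_in_bigo(2)[OF D[of v, unfolded expands_def] D'[of v, unfolded expands_def]]
    by (simp add: C_def left_diff_distrib sum_subtractf)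
  moreover have "(\<Sum>k\<le>v. C $ k * A $ (n - k)) = C $ v * A $ (n - v)" for n
  proof -
    have "C $ k = 0" if "k < v" for k
      using that unfolding v_def by (rule nth_less_subdegree_zero)
    then have "(\<Sum>k\<in>{..v} - {v}. C $ k * A $ (n - k)) = 0"
      by (intro sum.neutral) auto
    then show ?thesis
      using sum.remove[of "{..v}" v "\<lambda>k. C $ k * A $ (n - k)"] by simp
  qed
  ultimately show False
    using gargantuan_shift_not_bigo[OF a, of v "Suc v"] Cv by simp
qed

text \<open>For large \<open>n\<close> the coefficient of the product is itself a finite sum of the
  required shape; cutting it at \<open>r\<close> drops finitely many terms of later shifts.\<close>

lemma expands_of_finite_support:
  assumes a: "gargantuan (fps_nth A)" and D: "\<And>k. k > N \<Longrightarrow> D $ k = 0"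
  shows "expands A (D * A) D r"
proof -
  have eq: "(D * A) $ n - (\<Sum>k\<le>r. D $ k * A $ (n - k)) = (\<Sum>k\<in>{Suc r..N}. D $ k * A $ (n - k))"
    if n: "n \<ge> max r N" for n
  proof -
    have "{..n} = {..r} \<union> {Suc r..n}" using n by auto
    then have "(D * A) $ n - (\<Sum>k\<le>r. D $ k * A $ (n - k)) = (\<Sum>k\<in>{Suc r..n}. D $ k * A $ (n - k))"
      by (simp add: fps_mult_nth atLeast0AtMost sum.union_disjoint)
    also have "\<dots> = (\<Sum>k\<in>{Suc r..N}. D $ k * A $ (n - k))"
      using n D by (intro sum.mono_neutral_right) auto
    finally show ?thesis .
  qed
  have "(\<lambda>n. D $ k * A $ (n - k)) \<in> O(\<lambda>n. A $ (n - Suc r))" if "k \<in> {Suc r..N}" for k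
    using gargantuan_shift_bigo[OF a, of "Suc r" k] that by (cases "D $ k = 0") auto
  then have "(\<lambda>n. \<Sum>k\<in>{Suc r..N}. D $ k * A $ (n - k)) \<in> O(\<lambda>n. A $ (n - Suc r))"
    by (rule big_sum_in_bigo)
  then show ?thesis
    unfolding expands_def
    by (subst landau_o.big.in_cong[OF eventually_sequentiallyI[of "max r N"]]) (use eq in auto)
qed

section \<open>Expansions of a logarithm and of its powers\<close>

text \<open>Comparing coefficients in \<open>deriv\<close> writes \<open>A $ n\<close> as the sum of
  \<open>(k / n) * B $ k * A $ (n - k)\<close>. At the upper end the weight is
  \<open>1 - k / n\<close>; the term with \<open>k = 0\<close> there is \<open>B $ n\<close>, and
  the others are expanded by induction. Up to the error, the parts with factor \<open>1 / n\<close>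
  from the two ends cancel because \<open>zA * E = zB\<close>, and
  \<open>(A - 1) * E = 1 - E\<close> leaves the expansion with \<open>E\<close>.\<close>

lemma expands_log:
  assumes a: "gargantuan (fps_nth A)" and A0: "A $ 0 = 1" and B: "fps_nth B \<in> O(fps_nth A)"
    and deriv: "fps_deriv A = A * fps_deriv B" and E: "A * E = 1"
  shows "expands A B E r"
proof (induction r rule: less_induct)
  case (less r)
  define w :: "nat \<Rightarrow> nat \<Rightarrow> real" where "w = (\<lambda>n k. real k / real n)"
  \<comment> \<open>The operator \<open>x d/dx\<close> multiplies the coefficient at
    \<open>k\<close> by \<open>k\<close>.\<close>
  define zA zB where "zA = fps_X * fps_deriv A" and "zB = fps_X * fps_deriv B"
  have zA: "zA $ k = real k * A $ k" and zB: "zB $ k = real k * B $ k" for k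
    by (simp_all add: zA_def zB_def fps_mult_fps_X_deriv_shift)
  have zAB: "zA = zB * A" and zAE: "zA * E = zB"
    using E unfolding zA_def zB_def deriv by (simp_all add: mult_ac)
  have conv: "(\<Sum>k\<le>n. w n k * B $ k * A $ (n - k)) = A $ n" if "n > 0" for n
  proof -
    have "real n * A $ n = (\<Sum>k\<le>n. real k * B $ k * A $ (n - k))"
      using arg_cong[OF zAB, of "\<lambda>F. F $ n"] by (simp add: zA zB fps_mult_nth atLeast0AtMost)
    then show ?thesis
      using that by (simp add: w_def sum_divide_distrib[symmetric] field_simps)
  qed
  define X where "X = (\<lambda>n. (\<Sum>k\<le>n. w n k * B $ k * A $ (n - k)) -
      (\<Sum>k\<le>r. w n k * B $ k * A $ (n - k) + w n (n - k) * B $ (n - k) * A $ k))"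
  \<comment> \<open>Subtracting 1 removes the unknown \<open>B $ n\<close>; what remains, like the
    convolution with \<open>zA\<close>, is covered by the induction hypothesis.\<close>
  define Y where "Y = (\<lambda>n. (\<Sum>k\<le>r. (A - 1) $ k * B $ (n - k)) -
      (\<Sum>k\<le>r. ((A - 1) * E) $ k * A $ (n - k)))"
  define Z where "Z = (\<lambda>n. (\<Sum>k\<le>r. zA $ k * B $ (n - k)) - (\<Sum>k\<le>r. (zA * E) $ k * A $ (n - k)))"
  have X: "X \<in> O(\<lambda>n. A $ (n - Suc r))"
    unfolding X_def
    by (intro gargantuan_weighted_convolution a B) (auto simp: w_def divide_le_eq_1)
  have IH: "expands A B E (r - k)" if "k \<le> r" "k \<noteq> 0" for k
    using that by (intro less.IH) auto
  have Y: "Y \<in> O(\<lambda>n. A $ (n - Suc r))"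
    unfolding Y_def by (rule expands_partial_convolution) (metis A0 IH diff_self fps_one_nth fps_sub_nth)
  have Z: "Z \<in> O(\<lambda>n. A $ (n - Suc r))"
    unfolding Z_def by (rule expands_partial_convolution) (use IH zA in fastforce)
  have "(\<lambda>n. Z n / real n) \<in> O(Z)"
    by (intro landau_o.big_mono eventually_sequentiallyI[of 1])
       (simp add: divide_le_eq mult_le_cancel_left1)
  from landau_o.big_trans[OF this Z]
  have main: "(\<lambda>n. Z n / real n - (X n + Y n)) \<in> O(\<lambda>n. A $ (n - Suc r))"
    using sum_in_bigo(1)[OF X Y] by (rule sum_in_bigo(2))
  \<comment> \<open>An exact identity between the error sought and the three errors;
    \<open>n > r\<close> makes \<open>n - k\<close> a true difference and \<open>n\<close>
    nonzero.\<close>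
  have "B $ n - (\<Sum>k\<le>r. E $ k * A $ (n - k)) = Z n / real n - (X n + Y n)" if n: "n > r" for n
  proof -
    have X': "X n = A $ n - (\<Sum>k\<le>r. zB $ k * A $ (n - k)) / n - (\<Sum>k\<le>r. A $ k * B $ (n - k)) +
        (\<Sum>k\<le>r. zA $ k * B $ (n - k)) / n"
    proof -
      have "w n k * B $ k * A $ (n - k) + w n (n - k) * B $ (n - k) * A $ k =
          zB $ k * A $ (n - k) / n + A $ k * B $ (n - k) - zA $ k * B $ (n - k) / n"
        if "k \<le> r" for k
        using n that by (simp add: w_def zA zB of_nat_diff field_simps)
      then have "(\<Sum>k\<le>r. w n k * B $ k * A $ (n - k) + w n (n - k) * B $ (n - k) * A $ k) =
          (\<Sum>k\<le>r. zB $ k * A $ (n - k) / n + A $ k * B $ (n - k) - zA $ k * B $ (n - k) / n)"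
        by simp
      then show ?thesis
        using n conv[of n] by (simp add: X_def sum.distrib sum_subtractf sum_divide_distrib)
    qed
    have one: "(\<Sum>k\<le>r. (1 :: real fps) $ k * h k) = h 0" for h
      by (subst sum.remove[of _ 0]) auto
    have "(A - 1) * E = 1 - E"
      using E by (simp add: left_diff_distrib)
    then have Y': "Y n = (\<Sum>k\<le>r. A $ k * B $ (n - k)) - B $ n - A $ n +
        (\<Sum>k\<le>r. E $ k * A $ (n - k))"
      using one[of "\<lambda>k. B $ (n - k)"] one[of "\<lambda>k. A $ (n - k)"]
      by (simp add: Y_def left_diff_distrib sum_subtractf del: fps_one_nth)
    show ?thesis
      unfolding X' Y' by (simp add: Z_def zAE diff_divide_distrib)
  qed
  with main show ?case
    unfolding expands_def
    by (subst landau_o.big.in_cong[OF eventually_sequentiallyI[of "Suc r"]]) auto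
qed

text \<open>For \<open>B = log A\<close> and \<open>E = 1 / A\<close> this is the derivative of \<open>(log A) ^ m / m!\<close> in A.\<close>

definition log_power_deriv :: "real fps \<Rightarrow> real fps \<Rightarrow> nat \<Rightarrow> real fps" where
  "log_power_deriv B E m = (if m = 0 then 0 else fps_const (1 / fact (m - 1)) * B ^ (m - 1) * E)"

text \<open>The series 1 has eventually zero coefficients and so expands with 0. In the step,
  \<open>?H (Suc m)\<close> is \<open>?H m * B\<close> divided by \<open>Suc m\<close>, and the two
  summands of the product rule are 1 and \<open>m\<close> times \<open>?H m * E\<close>.\<close>

lemma expands_log_power:
  assumes a: "gargantuan (fps_nth A)" and B: "\<And>r. expands A B E r"
  shows "expands A (fps_const (1 / fact m) * B ^ m) (log_power_deriv B E m) r"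
proof (induction m arbitrary: r)
  case 0
  have "\<forall>\<^sub>F n in sequentially. (1 :: real fps) $ n = 0"
    by (rule eventually_sequentiallyI[of 1]) simp
  then show ?case
    by (simp add: expands_def log_power_deriv_def landau_o.big.in_cong)
next
  case (Suc m)
  let ?H = "\<lambda>m. fps_const (1 / fact m) * B ^ m"
  have split: "?H (Suc m) = fps_const (1 / real (Suc m)) * (?H m * B)"
    by (simp add: fps_const_mult[symmetric] mult_ac del: fps_const_mult)
  have deriv: "?H m * E + B * log_power_deriv B E m = fps_const (real (Suc m)) * (?H m * E)"
  proof (cases m)
    case (Suc j)
    define c where "c = fps_const (1 / fact m :: real)"
    have "1 / fact j = real m * (1 / fact m)"
      by (simp add: Suc del: of_nat_Suc)
    then have "fps_const (1 / fact j) = fps_const (real m) * c"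
      by (simp add: c_def)
    then have "B * log_power_deriv B E m = fps_const (real m) * (c * B ^ m * E)"
      by (simp add: log_power_deriv_def Suc mult_ac)
    moreover have "fps_const (real (Suc m)) = 1 + fps_const (real m)"
      by (simp flip: fps_const_add)
    ultimately show ?thesis
      unfolding c_def[symmetric] by (simp only: distrib_right mult_1_left)
  qed (simp add: log_power_deriv_def)
  have "fps_const (1 / real (Suc m)) * (fps_const (real (Suc m)) * F) = F" for F
    by (simp add: mult.assoc[symmetric] del: of_nat_Suc)
  then have "fps_const (1 / real (Suc m)) * (?H m * E + B * log_power_deriv B E m) =
      log_power_deriv B E (Suc m)"
    unfolding deriv by (simp add: log_power_deriv_def)
  with expands_cmult[OF expands_mult[OF a Suc.IH B], of "1 / real (Suc m)" r] show ?case
    unfolding split by (simp only:)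
qed

text \<open>With finite support, uniqueness would identify the derivative series for
  \<open>m\<close> and \<open>m - 1\<close>. For \<open>m = 1\<close> this says
  \<open>E = 0\<close>; for larger \<open>m\<close>, cancelling \<open>E\<close> and
  \<open>B ^ (m - 2)\<close> makes \<open>B\<close> a nonzero constant, against
  \<open>B0\<close>.\<close>

lemma log_power_deriv_infinite_support:
  assumes a: "gargantuan (fps_nth A)" and B: "\<And>r. expands A B E r"
    and E: "A * E = 1" and B0: "B $ 0 = 0" and m: "m > 0"
  shows "\<exists>k>N. log_power_deriv B E m $ k \<noteq> 0"
proof (rule ccontr)
  assume "\<not> ?thesis"
  then have fin: "log_power_deriv B E m $ k = 0" if "k > N" for k using that by blast
  have "log_power_deriv B E m * A = fps_const (1 / fact (m - 1)) * B ^ (m - 1)"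
    using E m by (simp add: log_power_deriv_def mult.assoc mult.commute[of E])
  with expands_of_finite_support[OF a fin] expands_log_power[OF a B]
  have eq: "log_power_deriv B E m = log_power_deriv B E (m - 1)"
    by (intro expands_unique[OF a]) auto
  have E0: "E \<noteq> 0" using E by auto
  show False
  proof (cases "m = 1")
    case True
    with eq E0 show False by (simp add: log_power_deriv_def)
  next
    case False
    then obtain j where j: "m = Suc (Suc j)"
      using m by (metis One_nat_def gr0_implies_Suc neq0_conv)
    \<comment> \<open>The zero series expands with 0, so uniqueness would give
      \<open>E = 0\<close>.\<close>
    have B_ne: "B \<noteq> 0"
    proof
      assume "B = 0"
      then have "expands A B 0 r" for r by (simp add: expands_def)
      with E0 expands_unique[OF a B] show False by blast
    qed
    have "fps_const (1 / fact (Suc j)) * B ^ Suc j = fps_const (1 / fact j) * B ^ j"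
      using eq E0 j by (simp add: log_power_deriv_def del: power_Suc fact_Suc)
    then have "(fps_const (1 / fact (Suc j)) * B - fps_const (1 / fact j)) * B ^ j = 0"
      by (simp add: algebra_simps)
    then have "fps_const (1 / fact (Suc j)) * B - fps_const (1 / fact j) = 0"
      using B_ne by simp
    from arg_cong[OF this, of "\<lambda>F. F $ 0"] B0 show False by simp
  qed
qed

section \<open>Total weights of composites and products\<close>

text \<open>Summability of reals is absolute, which yields summability on the whole product; the
  value then follows by iterated summation.\<close>

lemma has_sum_Times_mult:
  fixes f :: "'a \<Rightarrow> real" and g :: "'b \<Rightarrow> real"
  assumes f: "(f has_sum a) A" and g: "(g has_sum b) B"
  shows "((\<lambda>(x, y). f x * g y) has_sum a * b) (A \<times> B)"
proof (rule has_sum_SigmaI)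
  show "((\<lambda>y. case (x, y) of (x, y) \<Rightarrow> f x * g y) has_sum f x * b) B" for x
    using has_sum_cmult_right[OF g] by simp
  show "((\<lambda>x. f x * b) has_sum a * b) A"
    by (rule has_sum_cmult_left[OF f])
  have "(\<lambda>x. norm (f x)) summable_on A" "(\<lambda>y. norm (g y)) summable_on B"
    using has_sum_imp_summable[OF f] has_sum_imp_summable[OF g]
    by (simp_all only: summable_on_iff_abs_summable_on_real[symmetric])
  then have "(\<lambda>(x, y). norm (f x) * norm (g y)) summable_on A \<times> B"
    by (intro summable_on_SigmaI[where g = "\<lambda>x. norm (f x) * (\<Sum>\<^sub>\<infinity>y\<in>B. norm (g y))"])
       (auto intro!: has_sum_cmult_right has_sum_infsum summable_on_cmult_left)
  then show "(\<lambda>(x, y). f x * g y) summable_on A \<times> B"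
    by (subst summable_on_iff_abs_summable_on_real) (simp add: case_prod_unfold abs_mult)
qed

lemma has_sum_finite_Sigma:
  fixes f :: "'a \<times> 'b \<Rightarrow> real"
  assumes "finite I" and "\<And>i. i \<in> I \<Longrightarrow> ((\<lambda>x. f (i, x)) has_sum s i) (B i)"
  shows "(f has_sum (\<Sum>i\<in>I. s i)) (Sigma I B)"
  using assms
proof (induction I rule: finite_induct)
  case (insert i I)
  have "(f has_sum s i) (Pair i ` B i)"
    using insert.prems[of i] by (subst has_sum_reindex) (auto simp: o_def inj_on_def)
  moreover have "(f has_sum (\<Sum>i\<in>I. s i)) (Sigma I B)"
    by (intro insert.IH insert.prems) simp
  moreover have "Pair i ` B i \<inter> Sigma I B = {}" using insert.hyps by auto
  moreover have "Sigma (insert i I) B = Pair i ` B i \<union> Sigma I B" by auto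
  ultimately show ?case
    using insert.hyps has_sum_Un_disjoint by fastforce
qed simp

lemma has_sum_prod_PiE:
  fixes f :: "'a \<Rightarrow> 'b \<Rightarrow> real"
  assumes "finite I" and "\<And>i. i \<in> I \<Longrightarrow> (f i has_sum s i) (B i)"
  shows "((\<lambda>g. \<Prod>i\<in>I. f i (g i)) has_sum (\<Prod>i\<in>I. s i)) (PiE I B)"
  using assms
proof (induction I rule: finite_induct)
  case empty
  show ?case by (simp add: has_sum_finite_iff)
next
  case (insert i I)
  have "((\<lambda>(x, g). f i x * (\<Prod>j\<in>I. f j (g j))) has_sum s i * (\<Prod>j\<in>I. s j)) (B i \<times> PiE I B)"
    by (intro has_sum_Times_mult insert.IH insert.prems) auto
  also have "?this \<longleftrightarrow> ((\<lambda>g. \<Prod>j\<in>insert i I. f j (g j)) has_sum s i * (\<Prod>j\<in>I. s j))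
      (PiE (insert i I) B)"
  \<comment> \<open>An extensional function is its value at \<open>i\<close> together with the rest,
    reset to \<open>undefined\<close> at \<open>i\<close> so as to stay extensional on
    \<open>I\<close>.\<close>
  proof (rule has_sum_reindex_bij_witness[of _ "\<lambda>g. (g i, g(i := undefined))" "\<lambda>(x, g). g(i := x)"])
    fix p assume p: "p \<in> B i \<times> PiE I B"
    obtain x g where [simp]: "p = (x, g)" by (cases p)
    have "(\<Prod>j\<in>I. f j ((g(i := x)) j)) = (\<Prod>j\<in>I. f j (g j))"
      using insert.hyps by (intro prod.cong) auto
    then show "(\<Prod>j\<in>insert i I. f j ((case p of (x, g) \<Rightarrow> g(i := x)) j)) =
        (case p of (x, g) \<Rightarrow> f i x * (\<Prod>j\<in>I. f j (g j)))"
      using insert.hyps by simp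
    show "(case p of (x, g) \<Rightarrow> g(i := x)) \<in> PiE (insert i I) B"
      using p by (auto simp: PiE_iff extensional_def)
    show "((case p of (x, g) \<Rightarrow> g(i := x)) i, (case p of (x, g) \<Rightarrow> g(i := x))(i := undefined)) = p"
      using p insert.hyps by (auto simp: PiE_iff extensional_def fun_eq_iff)
  next
    fix g assume "g \<in> PiE (insert i I) B"
    then show "(g i, g(i := undefined)) \<in> B i \<times> PiE I B"
      using insert.hyps by (auto simp: PiE_iff extensional_def)
  qed auto
  finally show ?case using insert.hyps by simp
qed

text \<open>For each of the finitely many partitions, the outer structure and the structures on the
  blocks are chosen independently, so the inner sum factors.\<close>

lemma has_sum_compose_species:
  assumes U: "finite U"
    and F: "\<And>\<pi>. partition_on U \<pi> \<Longrightarrow> (weight F \<pi> has_sum f \<pi>) (structures F \<pi>)"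
    and B: "\<And>X. X \<subseteq> U \<Longrightarrow> (weight B X has_sum b X) (structures B X)"
  shows "(weight (compose_species F B) U has_sum (\<Sum>\<pi> | partition_on U \<pi>. f \<pi> * (\<Prod>X\<in>\<pi>. b X)))
           (structures (compose_species F B) U)"
proof -
  have "((\<lambda>(\<pi>, t, g). weight F \<pi> t * (\<Prod>X\<in>\<pi>. weight B X (g X))) has_sum
      (\<Sum>\<pi> | partition_on U \<pi>. f \<pi> * (\<Prod>X\<in>\<pi>. b X)))
      (SIGMA \<pi>:{\<pi>. partition_on U \<pi>}. structures F \<pi> \<times> (\<Pi>\<^sub>E X\<in>\<pi>. structures B X))"
  proof (rule has_sum_finite_Sigma)
    show "finite {\<pi>. partition_on U \<pi>}" by (rule finitely_many_partition_on[OF U])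
    fix \<pi> assume "\<pi> \<in> {\<pi>. partition_on U \<pi>}"
    then have \<pi>: "partition_on U \<pi>" by simp
    have "((\<lambda>g. \<Prod>X\<in>\<pi>. weight B X (g X)) has_sum (\<Prod>X\<in>\<pi>. b X)) (\<Pi>\<^sub>E X\<in>\<pi>. structures B X)"
      using partition_onD1[OF \<pi>] by (intro has_sum_prod_PiE finite_elements[OF U \<pi>] B) auto
    from has_sum_Times_mult[OF F[OF \<pi>] this]
    show "((\<lambda>x. case (\<pi>, x) of (\<pi>, t, g) \<Rightarrow> weight F \<pi> t * (\<Prod>X\<in>\<pi>. weight B X (g X))) has_sum
        f \<pi> * (\<Prod>X\<in>\<pi>. b X)) (structures F \<pi> \<times> (\<Pi>\<^sub>E X\<in>\<pi>. structures B X))"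
      by simp
  qed
  moreover have "structures (compose_species F B) U =
      (SIGMA \<pi>:{\<pi>. partition_on U \<pi>}. structures F \<pi> \<times> (\<Pi>\<^sub>E X\<in>\<pi>. structures B X))"
    by (auto simp: compose_species_def)
  ultimately show ?thesis by (simp add: compose_species_def)
qed

text \<open>The second set of a pair is the complement of the first, so the pairs are indexed by the
  subsets \<open>V\<close> of \<open>U\<close>.\<close>

lemma has_sum_product_species:
  assumes U: "finite U"
    and F: "\<And>V. V \<subseteq> U \<Longrightarrow> (weight F V has_sum f V) (structures F V)"
    and G: "\<And>V. V \<subseteq> U \<Longrightarrow> (weight G V has_sum g V) (structures G V)"
  shows "(weight (product_species F G) U has_sum (\<Sum>V\<in>Pow U. f V * g (U - V)))
           (structures (product_species F G) U)"
proof -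
  have complement: "V \<union> W - V = W" if "V \<inter> W = {}" for V W :: "'a set"
    using that by blast
  have "((\<lambda>(V, s, t). weight F V s * weight G (U - V) t) has_sum (\<Sum>V\<in>Pow U. f V * g (U - V)))
      (SIGMA V:Pow U. structures F V \<times> structures G (U - V))"
  proof (rule has_sum_finite_Sigma)
    fix V assume V: "V \<in> Pow U"
    show "((\<lambda>x. case (V, x) of (V, s, t) \<Rightarrow> weight F V s * weight G (U - V) t) has_sum
        f V * g (U - V)) (structures F V \<times> structures G (U - V))"
      using has_sum_Times_mult[OF F G, of V "U - V"] V by auto
  qed (use U in simp)
  also have "?this \<longleftrightarrow> ?thesis"
    by (rule has_sum_reindex_bij_witness[of _ "\<lambda>((V, s), (W, t)). (V, s, t)"
              "\<lambda>(V, s, t). ((V, s), (U - V, t))"])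
       (auto simp: product_species_def complement)
  finally show ?thesis .
qed

lemma total_weight_eqI:
  "(weight F U has_sum s) (structures F U) \<Longrightarrow> total_weight F U = s"
  unfolding total_weight_def by (rule infsumI)

lemma has_sum_total_weight:
  "is_species F \<Longrightarrow> finite U \<Longrightarrow> (weight F U has_sum total_weight F U) (structures F U)"
  unfolding is_species_def total_weight_def by simp

text \<open>Transport along the inverse bijection inverts transport along \<open>\<sigma>\<close>,
  which is therefore a weight-preserving bijection.\<close>

lemma total_weight_transport:
  assumes F: "is_species F" and U: "finite U" and \<sigma>: "inj_on \<sigma> U"
  shows "total_weight F (\<sigma> ` U) = total_weight F U"
proof -
  have tr: "transport F U \<sigma> s \<in> structures F (\<sigma> ` U)"
      "weight F (\<sigma> ` U) (transport F U \<sigma> s) = weight F U s"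
    if "finite U" "inj_on \<sigma> U" "s \<in> structures F U" for U \<sigma> s
    using F that by (simp_all add: is_species_def)
  have tr_id: "transport F U id s = s" if "finite U" "s \<in> structures F U" for U s
    using F that by (simp add: is_species_def)
  have tr_comp: "transport F U (\<tau> \<circ> \<sigma>) s = transport F (\<sigma> ` U) \<tau> (transport F U \<sigma> s)"
    if "finite U" "inj_on \<sigma> U" "inj_on \<tau> (\<sigma> ` U)" "s \<in> structures F U" for U \<sigma> \<tau> s
    using F that by (simp add: is_species_def)
  have tr_cong: "\<forall>U \<sigma> \<tau> s. finite U \<longrightarrow> inj_on \<sigma> U \<longrightarrow> (\<forall>u\<in>U. \<sigma> u = \<tau> u) \<longrightarrow>
      s \<in> structures F U \<longrightarrow> transport F U \<sigma> s = transport F U \<tau> s"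
    using F unfolding is_species_def by (elim conjE)
  \<comment> \<open>The composite agrees with the identity only on \<open>U\<close>, so
    \<open>tr_cong\<close> must replace it by \<open>id\<close> before \<open>tr_id\<close>
    applies.\<close>
  have inv: "transport F (\<sigma> ` U) \<tau> (transport F U \<sigma> s) = s"
    if "finite U" "inj_on \<sigma> U" "inj_on \<tau> (\<sigma> ` U)" "\<And>u. u \<in> U \<Longrightarrow> \<tau> (\<sigma> u) = u" "s \<in> structures F U"
    for U \<sigma> \<tau> s
  proof -
    have "transport F U (\<tau> \<circ> \<sigma>) s = transport F U id s"
      using that by (intro tr_cong[rule_format]) (auto simp: comp_inj_on)
    then show ?thesis
      using that by (simp add: tr_id tr_comp)
  qed
  let ?\<tau> = "inv_into U \<sigma>"
  have \<tau>: "inj_on ?\<tau> (\<sigma> ` U)" "?\<tau> ` \<sigma> ` U = U"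
    using \<sigma> by (auto simp: inj_on_inv_into image_image)
  have "bij_betw (transport F U \<sigma>) (structures F U) (structures F (\<sigma> ` U))"
  proof (rule bij_betw_byWitness[where f' = "transport F (\<sigma> ` U) ?\<tau>"])
    show "\<forall>s\<in>structures F U. transport F (\<sigma> ` U) ?\<tau> (transport F U \<sigma> s) = s"
      using inv[OF U \<sigma> \<tau>(1)] \<sigma> by simp
    show "\<forall>s\<in>structures F (\<sigma> ` U). transport F U \<sigma> (transport F (\<sigma> ` U) ?\<tau> s) = s"
      using inv[of "\<sigma> ` U" ?\<tau> \<sigma>] U \<sigma> \<tau> by (simp add: f_inv_into_f)
    show "transport F U \<sigma> ` structures F U \<subseteq> structures F (\<sigma> ` U)"
      using tr(1)[OF U \<sigma>] by blast
    show "transport F (\<sigma> ` U) ?\<tau> ` structures F (\<sigma> ` U) \<subseteq> structures F U"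
      using tr(1)[of "\<sigma> ` U" ?\<tau>] U \<tau> by auto
  qed
  from infsum_reindex_bij_betw[OF this, of "weight F (\<sigma> ` U)"]
  have "total_weight F (\<sigma> ` U) = (\<Sum>\<^sub>\<infinity>s\<in>structures F U. weight F (\<sigma> ` U) (transport F U \<sigma> s))"
    by (simp add: total_weight_def)
  also have "\<dots> = total_weight F U"
    unfolding total_weight_def using tr(2)[OF U \<sigma>] by (rule infsum_cong)
  finally show ?thesis .
qed

lemma total_weight_card:
  fixes F :: "(nat, 's) species"
  assumes "is_species F" "finite U"
  shows "total_weight F U = total_weight F {1..card U}"
proof -
  obtain h where "bij_betw h {1..card U} U"
    using ex_bij_betw_nat_finite_1[OF assms(2)] by blast
  then show ?thesis
    using total_weight_transport[OF assms(1), of "{1..card U}" h] by (auto simp: bij_betw_def)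
qed

section \<open>Exponential generating functions: sums over subsets and partitions\<close>

text \<open>All subsets of size \<open>k\<close> give the same summand, and their binomial number
  absorbs the factorials.\<close>

lemma sum_Pow_fps_mult:
  fixes F G :: "real fps"
  assumes U: "finite U"
  shows "(\<Sum>V\<in>Pow U. (fact (card V) * F $ card V) * (fact (card (U - V)) * G $ card (U - V))) =
         fact (card U) * (F * G) $ card U"
proof -
  let ?n = "card U"
  define h where "h = (\<lambda>k. (fact k * F $ k) * (fact (?n - k) * G $ (?n - k)))"
  have "(\<Sum>V\<in>Pow U. (fact (card V) * F $ card V) * (fact (card (U - V)) * G $ card (U - V))) =
      (\<Sum>V\<in>Pow U. h (card V))"
    using U by (intro sum.cong) (auto simp: h_def card_Diff_subset finite_subset)
  also have "\<dots> = (\<Sum>k\<in>{..?n}. \<Sum>V\<in>{V \<in> Pow U. card V = k}. h (card V))"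
    using U by (intro sum.group[symmetric]) (auto intro: card_mono)
  also have "\<dots> = (\<Sum>k\<in>{..?n}. real (?n choose k) * h k)"
  proof (rule sum.cong)
    fix k
    have "card {V \<in> Pow U. card V = k} = ?n choose k"
      using n_subsets[OF U, of k] by (simp add: Pow_def)
    then show "(\<Sum>V\<in>{V \<in> Pow U. card V = k}. h (card V)) = real (?n choose k) * h k"
      by simp
  qed simp
  also have "\<dots> = (\<Sum>k\<in>{..?n}. fact ?n * (F $ k * G $ (?n - k)))"
    by (intro sum.cong) (auto simp: h_def binomial_fact)
  also have "\<dots> = fact ?n * (F * G) $ ?n"
    by (simp add: fps_mult_nth atLeast0AtMost sum_distrib_left)
  finally show ?thesis .
qed

text \<open>Marking a block counts each partition into \<open>Suc k\<close> blocks
  \<open>Suc k\<close> times. Removing the marked block \<open>V\<close> leaves a partition of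
  \<open>U - V\<close> into \<open>k\<close> blocks, so the product formula adds one factor
  \<open>B\<close>.\<close>

lemma sum_partitions_of_card:
  fixes B :: "real fps" and U :: "'a set"
  assumes "finite U" and B0: "B $ 0 = 0"
  shows "(\<Sum>\<pi> | partition_on U \<pi> \<and> card \<pi> = k. \<Prod>X\<in>\<pi>. fact (card X) * B $ card X) =
         fact (card U) * (B ^ k $ card U) / fact k"
  using assms(1)
proof (induction k arbitrary: U)
  case 0
  have "{\<pi>. partition_on U \<pi> \<and> card \<pi> = 0} = (if U = {} then {{}} else {})"
    using finite_elements[OF 0] by (auto simp: partition_on_def)
  with 0 show ?case by auto
next
  case (Suc k)
  define \<beta> :: "'a set \<Rightarrow> real" where "\<beta> = (\<lambda>X. fact (card X) * B $ card X)"
  define P where "P = (\<lambda>k (U :: 'a set). {\<pi>. partition_on U \<pi> \<and> card \<pi> = k})"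
  have finP: "finite (P k U)" if "finite U" for k U
    using finitely_many_partition_on[OF that] by (simp add: P_def)
  have fin: "finite \<pi>" if "\<pi> \<in> P k U" "finite U" for \<pi> k U
    using that finite_elements unfolding P_def by blast
  have "real (Suc k) * (\<Sum>\<pi>\<in>P (Suc k) U. prod \<beta> \<pi>) = (\<Sum>\<pi>\<in>P (Suc k) U. \<Sum>X\<in>\<pi>. prod \<beta> \<pi>)"
    unfolding sum_distrib_left by (intro sum.cong refl) (simp add: P_def)
  also have "\<dots> = (\<Sum>(\<pi>, X)\<in>(SIGMA \<pi>:P (Suc k) U. \<pi>). prod \<beta> \<pi>)"
    by (intro sum.Sigma finP Suc.prems) (use fin[OF _ Suc.prems] in blast)
  also have "\<dots> = (\<Sum>(V, \<pi>)\<in>(SIGMA V:Pow U - {{}}. P k (U - V)). \<beta> V * prod \<beta> \<pi>)"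
  proof (rule sum.reindex_bij_witness[of _ "\<lambda>(V, \<pi>). (insert V \<pi>, V)" "\<lambda>(\<pi>, X). (X, \<pi> - {X})"])
    fix p assume "p \<in> (SIGMA \<pi>:P (Suc k) U. \<pi>)"
    then obtain \<pi> X where p: "p = (\<pi>, X)" "X \<in> \<pi>" "\<pi> \<in> P (Suc k) U" by blast
    have \<pi>: "partition_on U (insert X (\<pi> - {X}))" "card \<pi> = Suc k" "finite \<pi>"
      using p fin[OF p(3) Suc.prems] by (auto simp: P_def insert_absorb)
    have disj: "disjnt X (\<Union>(\<pi> - {X}))"
      using \<pi>(1) p(2) unfolding partition_on_def disjoint_def disjnt_def by blast
    have "partition_on (U - X) (\<pi> - {X})" "X \<subseteq> U" "X \<noteq> {}"
      using \<pi>(1) unfolding partition_on_insert[OF disj] by blast+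
    with \<pi> p(2) show "(case p of (\<pi>, X) \<Rightarrow> (X, \<pi> - {X})) \<in> (SIGMA V:Pow U - {{}}. P k (U - V))"
      by (simp add: p(1) P_def)
    show "(case case p of (\<pi>, X) \<Rightarrow> (X, \<pi> - {X}) of (V, \<pi>) \<Rightarrow> (insert V \<pi>, V)) = p"
      using p by auto
    show "(case case p of (\<pi>, X) \<Rightarrow> (X, \<pi> - {X}) of (V, \<pi>) \<Rightarrow> \<beta> V * prod \<beta> \<pi>) =
        (case p of (\<pi>, X) \<Rightarrow> prod \<beta> \<pi>)"
      using p \<pi> prod.remove[of \<pi> X \<beta>] by simp
  next
    fix p assume "p \<in> (SIGMA V:Pow U - {{}}. P k (U - V))"
    then obtain V \<pi> where p: "p = (V, \<pi>)" "V \<subseteq> U" "V \<noteq> {}" "\<pi> \<in> P k (U - V)" by blast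
    have \<pi>: "partition_on (U - V) \<pi>" "card \<pi> = k" "finite \<pi>"
      using p fin[OF p(4)] Suc.prems by (auto simp: P_def)
    have V: "disjnt V (\<Union>\<pi>)" "V \<notin> \<pi>"
      using \<pi>(1) p(3) by (auto simp: partition_on_def disjnt_def)
    show "(case p of (V, \<pi>) \<Rightarrow> (insert V \<pi>, V)) \<in> (SIGMA \<pi>:P (Suc k) U. \<pi>)"
      using p \<pi> V by (simp add: P_def partition_on_insert[OF V(1)])
    show "(case case p of (V, \<pi>) \<Rightarrow> (insert V \<pi>, V) of (\<pi>, X) \<Rightarrow> (X, \<pi> - {X})) = p"
      using p V by simp
  qed
  also have "\<dots> = (\<Sum>V\<in>Pow U - {{}}. \<beta> V * (\<Sum>\<pi>\<in>P k (U - V). prod \<beta> \<pi>))"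
    using Suc.prems by (subst sum.Sigma[symmetric]) (simp_all add: finP sum_distrib_left)
  \<comment> \<open>The empty block may be included because \<open>B0\<close> makes its factor
    zero.\<close>
  also have "\<dots> = (\<Sum>V\<in>Pow U. \<beta> V * (\<Sum>\<pi>\<in>P k (U - V). prod \<beta> \<pi>))"
    using Suc.prems B0 by (intro sum.mono_neutral_left) (auto simp: \<beta>_def)
  also have "\<dots> = (\<Sum>V\<in>Pow U. (fact (card V) * B $ card V) *
      (fact (card (U - V)) * (B ^ k) $ card (U - V))) / fact k"
    unfolding sum_divide_distrib
  proof (rule sum.cong)
    fix V
    have "(\<Sum>\<pi>\<in>P k (U - V). prod \<beta> \<pi>) = fact (card (U - V)) * (B ^ k $ card (U - V)) / fact k"
      using Suc.IH[of "U - V"] Suc.prems by (simp add: P_def \<beta>_def)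
    then show "\<beta> V * (\<Sum>\<pi>\<in>P k (U - V). prod \<beta> \<pi>) = (fact (card V) * B $ card V) *
      (fact (card (U - V)) * (B ^ k) $ card (U - V)) / fact k"
      by (simp add: \<beta>_def)
  qed simp
  also have "\<dots> = fact (card U) * (B ^ Suc k $ card U) / fact k"
    using sum_Pow_fps_mult[OF Suc.prems, of B "B ^ k"] by simp
  finally show ?case
    by (simp add: P_def \<beta>_def field_simps del: power_Suc of_nat_Suc)
qed

text \<open>Partitions are grouped by their number of blocks. Blocks being nonempty, there are at
  most \<open>card U\<close> of them, which is where the sum for the coefficient of the composition
  stops.\<close>

lemma sum_partitions_fps_compose:
  fixes B C :: "real fps" and U :: "'a set"
  assumes U: "finite U" and B0: "B $ 0 = 0"
  shows "(\<Sum>\<pi> | partition_on U \<pi>. (fact (card \<pi>) * C $ card \<pi>) * (\<Prod>X\<in>\<pi>. fact (card X) * B $ card X)) =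
         fact (card U) * (C oo B) $ card U"
proof -
  define \<beta> :: "'a set \<Rightarrow> real" where "\<beta> = (\<lambda>X. fact (card X) * B $ card X)"
  define P where "P = {\<pi>. partition_on U \<pi>}"
  have finP: "finite P"
    unfolding P_def by (rule finitely_many_partition_on[OF U])
  have card_le: "card \<pi> \<le> card U" if "\<pi> \<in> P" for \<pi>
  proof -
    have \<pi>: "partition_on U \<pi>" using that by (simp add: P_def)
    have X: "finite X" "X \<noteq> {}" if "X \<in> \<pi>" for X
      using that partition_onD1[OF \<pi>] partition_onD3[OF \<pi>] finite_subset[OF _ U] by auto
    have "card \<pi> = (\<Sum>X\<in>\<pi>. 1)" by simp
    also have "\<dots> \<le> (\<Sum>X\<in>\<pi>. card X)"
      using X by (intro sum_mono) (simp add: Suc_le_eq card_gt_0_iff)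
    also have "\<dots> = card U"
      using product_partition[OF \<pi> X(1)] by simp
    finally show ?thesis .
  qed
  have "(\<Sum>\<pi>\<in>P. (fact (card \<pi>) * C $ card \<pi>) * prod \<beta> \<pi>) =
      (\<Sum>k\<le>card U. \<Sum>\<pi>\<in>{\<pi> \<in> P. card \<pi> = k}. (fact (card \<pi>) * C $ card \<pi>) * prod \<beta> \<pi>)"
    using finP card_le by (intro sum.group[symmetric]) auto
  also have "\<dots> = (\<Sum>k\<le>card U. fact k * C $ k * (\<Sum>\<pi>\<in>{\<pi> \<in> P. card \<pi> = k}. prod \<beta> \<pi>))"
    by (simp add: sum_distrib_left)
  also have "\<dots> = (\<Sum>k\<le>card U. fact (card U) * (C $ k * B ^ k $ card U))"
    using sum_partitions_of_card[OF U B0] by (intro sum.cong) (simp_all add: P_def \<beta>_def)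
  also have "\<dots> = fact (card U) * (C oo B) $ card U"
    by (simp add: fps_compose_nth sum_distrib_left atLeast0AtMost)
  finally show ?thesis by (simp add: P_def \<beta>_def)
qed

section \<open>The inverse of the species of sets\<close>

text \<open>Each entry repeats its block, the only structure on a nonempty set being the set itself;
  the lists are thus ordered set partitions.\<close>

lemma power_nonempty_sets_iff:
  "xs \<in> structures (power_species nonempty_sets k) W \<longleftrightarrow>
     length xs = k \<and> (\<Union>i<k. fst (xs ! i)) = W \<and>
     (\<forall>i<k. \<forall>j<k. i \<noteq> j \<longrightarrow> fst (xs ! i) \<inter> fst (xs ! j) = {}) \<and>
     (\<forall>i<k. fst (xs ! i) \<noteq> {} \<and> snd (xs ! i) = fst (xs ! i))"
proof -
  have "s \<in> structures nonempty_sets V \<longleftrightarrow> V \<noteq> {} \<and> s = V" for s V :: "'a set"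
    by (simp add: nonempty_sets_def restrict_species_def set_species_def)
  then show ?thesis by (simp add: power_species_def)
qed

lemma power_nonempty_sets_Cons:
  "y # ys \<in> structures (power_species nonempty_sets (Suc k)) W \<longleftrightarrow>
   (\<exists>V\<in>Pow W - {{}}. y = (V, V) \<and> ys \<in> structures (power_species nonempty_sets k) (W - V))"
proof -
  obtain V s where y: "y = (V, s)" by (cases y)
  define T where "T = (\<Union>i<k. fst (ys ! i))"
  have union: "(\<Union>i<Suc k. fst ((y # ys) ! i)) = V \<union> T"
    by (simp add: lessThan_Suc_eq_insert_0 T_def y image_image)
  have disjoint: "(\<forall>i<Suc k. \<forall>j<Suc k. i \<noteq> j \<longrightarrow> fst ((y # ys) ! i) \<inter> fst ((y # ys) ! j) = {}) \<longleftrightarrow>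
      V \<inter> T = {} \<and> (\<forall>i<k. \<forall>j<k. i \<noteq> j \<longrightarrow> fst (ys ! i) \<inter> fst (ys ! j) = {})"
  proof -
    have split: "(\<forall>i<Suc k. \<forall>j<Suc k. P i j) \<longleftrightarrow>
        P 0 0 \<and> (\<forall>j<k. P 0 (Suc j)) \<and> (\<forall>i<k. P (Suc i) 0) \<and> (\<forall>i<k. \<forall>j<k. P (Suc i) (Suc j))" for P
      unfolding All_less_Suc2 by (rule iffI; intro conjI allI impI; simp)
    have VT: "(\<forall>j<k. V \<inter> fst (ys ! j) = {}) \<longleftrightarrow> V \<inter> T = {}"
        "(\<forall>j<k. fst (ys ! j) \<inter> V = {}) \<longleftrightarrow> V \<inter> T = {}"
      unfolding T_def by blast+
    show ?thesis
      unfolding split by (simp add: y VT)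
  qed
  have VT: "V \<union> T = W \<and> V \<inter> T = {} \<longleftrightarrow> V \<subseteq> W \<and> T = W - V"
    by blast
  have "y # ys \<in> structures (power_species nonempty_sets (Suc k)) W \<longleftrightarrow>
      length ys = k \<and> (V \<union> T = W \<and> V \<inter> T = {}) \<and>
      (\<forall>i<k. \<forall>j<k. i \<noteq> j \<longrightarrow> fst (ys ! i) \<inter> fst (ys ! j) = {}) \<and> V \<noteq> {} \<and> s = V \<and>
      (\<forall>i<k. fst (ys ! i) \<noteq> {} \<and> snd (ys ! i) = fst (ys ! i))"
    unfolding power_nonempty_sets_iff union disjoint unfolding All_less_Suc2 y
    by (simp only: length_Cons nat.inject nth_Cons_0 nth_Cons_Suc fst_conv snd_conv conj_assoc)
  also have "\<dots> \<longleftrightarrow> V \<in> Pow W - {{}} \<and> s = V \<and> ys \<in> structures (power_species nonempty_sets k) (W - V)"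
    unfolding power_nonempty_sets_iff VT T_def[symmetric] by (simp only: Pow_iff Diff_iff singleton_iff) argo
  finally show ?thesis by (auto simp: y)
qed

lemma power_nonempty_sets_0:
  "structures (power_species nonempty_sets 0) W = (if W = {} then {[]} else {})"
  by (auto simp: power_species_def)

lemma finite_power_nonempty_sets:
  assumes "finite W"
  shows "finite (structures (power_species nonempty_sets k) W)"
proof (rule finite_subset)
  show "finite {xs. set xs \<subseteq> Pow W \<times> Pow W \<and> length xs = k}"
    using assms by (intro finite_lists_length_eq) simp
  show "structures (power_species nonempty_sets k) W \<subseteq> {xs. set xs \<subseteq> Pow W \<times> Pow W \<and> length xs = k}"
    by (fastforce simp: power_species_def nonempty_sets_def restrict_species_def set_species_def
        in_set_conv_nth split: if_splits)
qed

text \<open>Splitting off the first block gives one factor \<open>fps_exp 1 - 1\<close>, the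
  exponential generating function of nonempty sets.\<close>

lemma card_power_nonempty_sets:
  assumes "finite W"
  shows "real (card (structures (power_species nonempty_sets k) W)) =
         fact (card W) * ((fps_exp 1 - 1) ^ k $ card W)"
  using assms
proof (induction k arbitrary: W)
  case 0
  then show ?case by (auto simp: power_nonempty_sets_0)
next
  case (Suc k)
  define L where "L = (\<lambda>W :: 'a set. structures (power_species nonempty_sets k) W)"
  have step: "structures (power_species nonempty_sets (Suc k)) W =
      (\<lambda>(V, ys). (V, V) # ys) ` (SIGMA V:Pow W - {{}}. L (W - V))" (is "?S = _")
  proof (rule set_eqI)
    fix xs
    show "xs \<in> ?S \<longleftrightarrow> xs \<in> (\<lambda>(V, ys). (V, V) # ys) ` (SIGMA V:Pow W - {{}}. L (W - V))"
    proof (cases xs)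
      case Nil
      then show ?thesis by (auto simp: power_species_def)
    next
      case (Cons y ys)
      then show ?thesis by (auto simp: power_nonempty_sets_Cons L_def)
    qed
  qed
  have fin: "finite (L (W - V))" for V
    using Suc.prems by (simp add: L_def finite_power_nonempty_sets)
  have "inj_on (\<lambda>(V, ys). (V, V) # ys) X" for X :: "('a set \<times> ('a set \<times> 'a set) list) set"
    by (auto simp: inj_on_def)
  then have "card ?S = (\<Sum>V\<in>Pow W - {{}}. card (L (W - V)))"
    unfolding step using Suc.prems
    using fin by (subst card_image, blast, subst card_SigmaI) auto
  then have "real (card ?S) = (\<Sum>V\<in>Pow W - {{}}. real (card (L (W - V))))"
    by simp
  \<comment> \<open>The new factor is 1 for nonempty \<open>V\<close> and 0 for the empty set, so
    the sum extends to all subsets.\<close>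
  also have "\<dots> = (\<Sum>V\<in>Pow W. (fact (card V) * (fps_exp 1 - 1) $ card V) *
      (fact (card (W - V)) * ((fps_exp 1 - 1) ^ k $ card (W - V))))"
  proof (rule sum.mono_neutral_cong_left)
    fix V assume V: "V \<in> Pow W - {{}}"
    then have "finite V" using Suc.prems finite_subset by blast
    with V have "card V \<noteq> 0" by auto
    then show "real (card (L (W - V))) = (fact (card V) * (fps_exp 1 - 1) $ card V) *
      (fact (card (W - V)) * ((fps_exp 1 - 1) ^ k $ card (W - V)))"
      using Suc.IH[of "W - V"] Suc.prems by (simp add: L_def)
  qed (use Suc.prems in auto)
  also have "\<dots> = fact (card W) * ((fps_exp 1 - 1) ^ Suc k $ card W)"
    unfolding power_Suc by (rule sum_Pow_fps_mult[OF Suc.prems])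
  finally show ?case .
qed

text \<open>Without constant term, \<open>fps_exp 1 - 1\<close> has a \<open>k\<close>-th power
  vanishing below degree \<open>k\<close>, so the count is zero. The infinite sum of powers is
  thereby finite on each finite set.\<close>

lemma power_nonempty_sets_empty:
  assumes "finite W" "k > card W"
  shows "structures (power_species nonempty_sets k) W = {}"
proof -
  have "(fps_exp 1 - 1 :: real fps) ^ k $ card W = 0"
    using assms(2) startsby_zero_power_prefix[of "fps_exp 1 - 1 :: real fps" k] by simp
  with card_power_nonempty_sets[OF assms(1), of k] finite_power_nonempty_sets[OF assms(1), of k]
  show ?thesis by simp
qed

lemma has_sum_sum_power_nonempty_sets:
  assumes W: "finite W"
  shows "(weight (sum_species I (power_species nonempty_sets)) W has_sum
           (\<Sum>k\<in>I \<inter> {..card W}. fact (card W) * ((fps_exp 1 - 1) ^ k $ card W)))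
         (structures (sum_species I (power_species nonempty_sets)) W)"
proof -
  let ?L = "\<lambda>k. structures (power_species nonempty_sets k) W"
  have wt: "weight (power_species nonempty_sets k) W xs = 1" for k xs
    by (simp add: power_species_def nonempty_sets_def restrict_species_def set_species_def)
  have "((\<lambda>(k, xs). weight (power_species nonempty_sets k) W xs) has_sum
           (\<Sum>k\<in>I \<inter> {..card W}. fact (card W) * ((fps_exp 1 - 1) ^ k $ card W)))
         (Sigma (I \<inter> {..card W}) ?L)"
    by (rule has_sum_finite_Sigma)
       (auto intro!: has_sum_finiteI finite_power_nonempty_sets W
             simp: wt card_power_nonempty_sets[OF W])
  moreover have "structures (sum_species I (power_species nonempty_sets)) W =
      Sigma (I \<inter> {..card W}) ?L"
    using power_nonempty_sets_empty[OF W] by (auto simp: sum_species_def intro: leI)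
  ultimately show ?thesis by (simp add: sum_species_def)
qed

text \<open>Substituting \<open>fps_exp 1 - 1\<close> into the geometric series of
  \<open>1 / (1 + fps_X)\<close> gives \<open>1 / fps_exp 1\<close>. Powers beyond \<open>n\<close>
  have no coefficient at \<open>n\<close>, so the finite sums are complete.\<close>

lemma alternating_sum_exp_minus_one_powers:
  "(\<Sum>k\<in>{k. even k} \<inter> {..n}. (fps_exp 1 - 1) ^ k $ n) -
   (\<Sum>k\<in>{k. odd k} \<inter> {..n}. (fps_exp 1 - 1) ^ k $ n) = fps_exp (-1 :: real) $ n"
proof -
  let ?E = "fps_exp 1 - 1 :: real fps"
  have inv: "inverse (1 + fps_X) oo ?E = fps_exp (-1)"
    by (subst fps_inverse_compose)
       (simp_all add: fps_compose_add_distrib fps_X_fps_compose_startby0 fps_exp_neg)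
  have "(\<Sum>k\<in>{k. even k} \<inter> {..n}. ?E ^ k $ n) - (\<Sum>k\<in>{k. odd k} \<inter> {..n}. ?E ^ k $ n) =
      (\<Sum>k\<in>{k. even k} \<inter> {..n}. (-1) ^ k * (?E ^ k $ n)) +
      (\<Sum>k\<in>{k. odd k} \<inter> {..n}. (-1) ^ k * (?E ^ k $ n))"
    by (simp add: sum_negf)
  also have "\<dots> = (\<Sum>k\<in>({k. even k} \<inter> {..n}) \<union> ({k. odd k} \<inter> {..n}). (-1) ^ k * (?E ^ k $ n))"
    by (rule sum.union_disjoint[symmetric]) auto
  also have "({k. even k} \<inter> {..n}) \<union> ({k. odd k} \<inter> {..n}) = {0..n}"
    by auto
  also have "(\<Sum>k\<in>{0..n}. (-1) ^ k * (?E ^ k $ n)) = (inverse (1 + fps_X) oo ?E) $ n"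
    by (simp add: fps_compose_nth fps_inverse_fps_X_plus1)
  finally show ?thesis by (simp add: inv)
qed

section \<open>Generating functions of A, of its m-component part and of D(m)\<close>

lemma has_sum_set_compose:
  assumes U: "finite U" and B0: "B $ 0 = 0"
    and B: "\<And>X. finite X \<Longrightarrow> (weight \<B> X has_sum fact (card X) * B $ card X) (structures \<B> X)"
  shows "(weight (compose_species set_species \<B>) U has_sum fact (card U) * (fps_exp 1 oo B) $ card U)
           (structures (compose_species set_species \<B>) U)"
proof -
  have "(weight (compose_species set_species \<B>) U has_sum
      (\<Sum>\<pi> | partition_on U \<pi>. (fact (card \<pi>) * fps_exp 1 $ card \<pi>) *
        (\<Prod>X\<in>\<pi>. fact (card X) * B $ card X)))
      (structures (compose_species set_species \<B>) U)"
    using U finite_subset by (intro has_sum_compose_species B) (auto simp: set_species_def has_sum_finite_iff)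
  then show ?thesis
    unfolding sum_partitions_fps_compose[OF U B0] .
qed

text \<open>The total weight of the outer species on \<open>k\<close> blocks, 1 for
  \<open>k = m\<close> and 0 otherwise, is \<open>fact k\<close> times the coefficient of
  \<open>fps_X ^ m / fact m\<close> at \<open>k\<close>.\<close>

lemma has_sum_component_species:
  assumes U: "finite U" and B0: "B $ 0 = 0"
    and B: "\<And>X. finite X \<Longrightarrow> (weight \<B> X has_sum fact (card X) * B $ card X) (structures \<B> X)"
  shows "(weight (component_species \<B> (int m)) U has_sum
            fact (card U) * (fps_const (1 / fact m) * B ^ m) $ card U)
           (structures (component_species \<B> (int m)) U)"
proof -
  let ?C = "fps_const (1 / fact m) * fps_X ^ m :: real fps"
  have "(weight (component_species \<B> (int m)) U has_sum
      (\<Sum>\<pi> | partition_on U \<pi>. (fact (card \<pi>) * ?C $ card \<pi>) *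
        (\<Prod>X\<in>\<pi>. fact (card X) * B $ card X)))
      (structures (component_species \<B> (int m)) U)"
    unfolding component_species_def using U finite_subset
    by (intro has_sum_compose_species B)
       (auto simp: sets_of_card_def restrict_species_def set_species_def has_sum_finite_iff)
  moreover have "?C oo B = fps_const (1 / fact m) * B ^ m"
    using B0 by (simp add: fps_compose_mult_distrib fps_compose_power[symmetric] fps_X_fps_compose_startby0)
  ultimately show ?thesis
    unfolding sum_partitions_fps_compose[OF U B0] by simp
qed

text \<open>The totals of the positive and the negative part are computed at once for a general
  index set \<open>I\<close>; in their difference the alternating sum becomes
  \<open>fps_exp (-1)\<close>.\<close>

lemma virtual_total_weight_coefficient_species:
  assumes U: "finite U" and B0: "B $ 0 = 0"
    and B: "\<And>X. finite X \<Longrightarrow> (weight \<B> X has_sum fact (card X) * B $ card X) (structures \<B> X)"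
  shows "virtual_total_weight (coefficient_species \<B> (int m)) U =
         fact (card U) * log_power_deriv B (fps_exp (-1) oo B) m $ card U"
proof -
  \<comment> \<open>For \<open>m = 0\<close> the index \<open>int m - 1\<close> is -1: no partition
    has that many blocks, and the total is 0.\<close>
  define c where "c = (if m = 0 then 0 else fps_const (1 / fact (m - 1)) * B ^ (m - 1))"
  have comp: "(weight (component_species \<B> (int m - 1)) V has_sum fact (card V) * c $ card V)
      (structures (component_species \<B> (int m - 1)) V)" if "finite V" for V
  proof (cases m)
    case 0
    then have "structures (component_species \<B> (int m - 1)) V = {}"
      by (auto simp: component_species_def compose_species_def sets_of_card_def restrict_species_def)
    with 0 show ?thesis by (simp add: c_def)
  next
    case (Suc j)
    then show ?thesis
      using has_sum_component_species[OF that B0 B, of j] by (simp add: c_def)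
  qed
  define e where "e = (\<lambda>I (W :: 'a set set).
      \<Sum>k\<in>I \<inter> {..card W}. fact (card W) * ((fps_exp 1 - 1 :: real fps) ^ k $ card W))"
  define t where "t = (\<lambda>I V. \<Sum>\<pi> | partition_on V \<pi>. e I \<pi> * (\<Prod>X\<in>\<pi>. fact (card X) * B $ card X))"
  have tot: "total_weight (product_species (component_species \<B> (int m - 1))
        (compose_species (sum_species I (power_species nonempty_sets)) \<B>)) U =
      (\<Sum>V\<in>Pow U. (fact (card V) * c $ card V) * t I (U - V))" for I
  proof (intro total_weight_eqI has_sum_product_species U)
    fix V assume "V \<subseteq> U"
    with U have V: "finite V" by (rule finite_subset[rotated])
    show "(weight (component_species \<B> (int m - 1)) V has_sum fact (card V) * c $ card V)
      (structures (component_species \<B> (int m - 1)) V)" by (rule comp[OF V])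
    show "(weight (compose_species (sum_species I (power_species nonempty_sets)) \<B>) V has_sum t I V)
      (structures (compose_species (sum_species I (power_species nonempty_sets)) \<B>) V)"
      unfolding t_def e_def
      by (intro has_sum_compose_species V B has_sum_sum_power_nonempty_sets)
         (auto intro: finite_elements[OF V] finite_subset[OF _ V])
  qed
  have diff: "t {k. even k} V - t {k. odd k} V = fact (card V) * (fps_exp (-1) oo B) $ card V"
    if V: "finite V" for V
  proof -
    have "t {k. even k} V - t {k. odd k} V = (\<Sum>\<pi> | partition_on V \<pi>.
        (fact (card \<pi>) * fps_exp (-1) $ card \<pi>) * (\<Prod>X\<in>\<pi>. fact (card X) * B $ card X))"
      unfolding t_def e_def alternating_sum_exp_minus_one_powers[symmetric]
      by (simp only: sum_subtractf[symmetric] left_diff_distrib[symmetric]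
          right_diff_distrib sum_distrib_left)
    also have "\<dots> = fact (card V) * (fps_exp (-1) oo B) $ card V"
      by (rule sum_partitions_fps_compose[OF V B0])
    finally show ?thesis .
  qed
  have "virtual_total_weight (coefficient_species \<B> (int m)) U =
      (\<Sum>V\<in>Pow U. (fact (card V) * c $ card V) * t {k. even k} (U - V)) -
      (\<Sum>V\<in>Pow U. (fact (card V) * c $ card V) * t {k. odd k} (U - V))"
    by (simp add: virtual_total_weight_def coefficient_species_def virtual_product_def
        virtual_compose_def inverse_set_species_def tot)
  also have "\<dots> = (\<Sum>V\<in>Pow U. (fact (card V) * c $ card V) *
      (fact (card (U - V)) * (fps_exp (-1) oo B) $ card (U - V)))"
    using U by (simp add: sum_subtractf[symmetric] right_diff_distrib[symmetric] diff)
  also have "\<dots> = fact (card U) * (c * (fps_exp (-1) oo B)) $ card U"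
    by (rule sum_Pow_fps_mult[OF U])
  finally show ?thesis
    by (simp add: c_def log_power_deriv_def)
qed

section \<open>Probabilities and their expansion\<close>

text \<open>Positive summable weights with nonzero sum can be normalised, so
  \<open>embed_pmf\<close> returns the intended point probabilities. The set of structures may be
  infinite.\<close>

lemma prob_random_structure:
  assumes F: "is_species F" "positive_weights F" and U: "finite U"
    and nz: "total_weight F U \<noteq> 0" and S: "S \<subseteq> structures F U"
  shows "measure_pmf.prob (random_structure F U) S = infsum (weight F U) S / total_weight F U"
proof -
  define p where "p = (\<lambda>s. if s \<in> structures F U then weight F U s / total_weight F U else 0)"
  have w: "weight F U s > 0" if "s \<in> structures F U" for s
    using F(2) U that by (simp add: positive_weights_def)
  have pos: "total_weight F U > 0"
    using nz infsum_nonneg[of "structures F U" "weight F U"] w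
    by (fastforce simp: total_weight_def less_le)
  have has: "(p has_sum infsum (weight F U) T / total_weight F U) T" if "T \<subseteq> structures F U" for T
  proof -
    have "weight F U summable_on T"
      using has_sum_imp_summable[OF has_sum_total_weight[OF F(1) U]] that
      by (rule summable_on_subset_banach)
    then have "((\<lambda>s. weight F U s * inverse (total_weight F U)) has_sum
        infsum (weight F U) T * inverse (total_weight F U)) T"
      by (intro has_sum_cmult_left has_sum_infsum)
    also have "?this \<longleftrightarrow> ?thesis"
      unfolding divide_inverse using that by (intro has_sum_cong) (auto simp: p_def divide_inverse)
    finally show ?thesis .
  qed
  have nonneg: "p s \<ge> 0" for s
    using w pos by (simp add: p_def less_imp_le)
  have one: "(p has_sum 1) UNIV"
  proof -
    have "(p has_sum 1) (structures F U)"
      using has[of "structures F U"] nz by (simp add: total_weight_def)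
    also have "?this \<longleftrightarrow> ?thesis"
      by (rule has_sum_cong_neutral) (auto simp: p_def)
    finally show ?thesis .
  qed
  \<comment> \<open>The measure of a set is obtained as an \<open>infsetsum\<close>, whose absolute
    summability is derived here from \<open>summable_on\<close>.\<close>
  have summable: "Infinite_Set_Sum.abs_summable_on p T" for T
  proof -
    have "p summable_on T"
      using has_sum_imp_summable[OF one] by (rule summable_on_subset_banach) simp
    then have "(\<lambda>s. norm (p s)) summable_on T"
      by (simp only: summable_on_iff_abs_summable_on_real[symmetric])
    then show ?thesis by (simp only: abs_summable_equivalent)
  qed
  have "(\<integral>\<^sup>+ s. ennreal (p s) \<partial>count_space UNIV) = 1"
    using nn_integral_conv_infsetsum[OF summable nonneg, of UNIV]
      infsetsum_infsum[OF summable] infsumI[OF one] by simp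
  then have pmf: "pmf (random_structure F U) s = p s" for s
    unfolding random_structure_def p_def[symmetric] by (intro pmf_embed_pmf nonneg)
  have "measure_pmf.prob (random_structure F U) S = infsetsum p S"
    by (simp add: measure_pmf_conv_infsetsum pmf[abs_def])
  also have "\<dots> = infsum p S"
    by (rule infsetsum_infsum[OF summable])
  also have "\<dots> = infsum (weight F U) S / total_weight F U"
    by (rule infsumI[OF has[OF S]])
  finally show ?thesis .
qed

section \<open>From \<open>expands\<close> to \<open>asymptotic_expansion\<close>\<close>

text \<open>Division by \<open>A $ n\<close> turns the errors into multiples of terms
  \<open>f k\<close>. With infinitely many nonzero coefficients a next term always exists; in the
  other case of \<open>D\<close> everything vanishes eventually and the expansion is exact.\<close>

lemma asymptotic_expansion_of_expands:
  assumes a: "gargantuan (fps_nth A)" and F: "\<And>r. expands A F D r"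
    and D: "(\<forall>N. \<exists>k>N. D $ k \<noteq> 0) \<or> D = 0 \<and> (\<forall>\<^sub>F n in sequentially. F $ n = 0)"
    and x: "\<forall>\<^sub>F n in sequentially. x n = F $ n / A $ n"
    and f: "\<And>k. \<forall>\<^sub>F n in sequentially. f k n = D $ k * A $ (n - k) / A $ n"
  shows "asymptotic_expansion x 0 f"
proof -
  have nz: "\<forall>\<^sub>F n in sequentially. A $ n \<noteq> 0"
    using a by (simp add: gargantuan_def)
  have nz': "\<forall>\<^sub>F n in sequentially. A $ (n - k) \<noteq> 0" for k
    using nz filterlim_minus_const_nat_at_top[of k] unfolding filterlim_iff by blast
  have van: "vanishing (f k) \<longleftrightarrow> D $ k = 0" for k
  proof
    assume "vanishing (f k)"
    then have "\<forall>\<^sub>F n :: nat in sequentially. D $ k = 0"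
      using f[of k] nz nz'[of k] unfolding vanishing_def by eventually_elim auto
    then show "D $ k = 0" by simp
  next
    assume "D $ k = 0"
    with f[of k] show "vanishing (f k)"
      unfolding vanishing_def by (auto elim: eventually_mono)
  qed
  have err: "\<forall>\<^sub>F n in sequentially. x n - (\<Sum>k=0..r. f k n) =
      (F $ n - (\<Sum>k\<le>r. D $ k * A $ (n - k))) / A $ n" for r
  proof -
    have "\<forall>\<^sub>F n in sequentially. \<forall>k\<in>{0..r}. f k n = D $ k * A $ (n - k) / A $ n"
      using f by (intro eventually_ball_finite) auto
    with x show ?thesis
      by eventually_elim (simp add: atLeast0AtMost diff_divide_distrib sum_divide_distrib)
  qed
  show ?thesis
  proof (cases "D = 0")
    case True
    with D have F0: "\<forall>\<^sub>F n in sequentially. F $ n = 0" by auto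
    have "next_term f r = (\<lambda>n. 0)" for r
      using True van by (simp add: next_term_def)
    moreover have "\<forall>\<^sub>F n in sequentially. x n - (\<Sum>k=0..r. f k n) = 0" for r
      using err[of r] F0 by eventually_elim (simp add: True)
    ultimately show ?thesis
      using True van unfolding asymptotic_expansion_def
      by (simp add: landau_o.big.in_cong)
  next
    case False
    with D have inf: "\<exists>k>N. D $ k \<noteq> 0" for N by blast
    define j where "j = (\<lambda>r. LEAST j. j > r \<and> D $ j \<noteq> 0)"
    have j: "j r > r" "D $ j r \<noteq> 0" for r
      using LeastI_ex[OF inf[of r]] by (auto simp: j_def)
    have gap: "D $ k = 0" if "r < k" "k < j r" for k r
      using not_less_Least[of k "\<lambda>j. j > r \<and> D $ j \<noteq> 0"] that by (auto simp: j_def)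
    have next_j: "next_term f r = f (j r)" for r
      using inf[of r] by (simp add: next_term_def van j_def)
    have f_theta: "L \<in> O(\<lambda>n. A $ (n - k)) \<Longrightarrow> (\<lambda>n. L n / A $ n) \<in> O(f k)" if "D $ k \<noteq> 0" for k L
    proof -
      assume "L \<in> O(\<lambda>n. A $ (n - k))"
      then have "(\<lambda>n. L n * inverse (A $ n)) \<in> O(\<lambda>n. A $ (n - k) * inverse (A $ n))"
        by (rule landau_o.big.mult_right)
      also have "(\<lambda>n. A $ (n - k) * inverse (A $ n)) \<in> O(\<lambda>n. D $ k * (A $ (n - k) * inverse (A $ n)))"
        using that by simp
      also have "\<dots> = O(f k)"
        by (rule landau_o.big.cong) (use f[of k] in \<open>eventually_elim, simp add: divide_inverse\<close>)
      finally show ?thesis by (simp add: divide_inverse)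
    qed
    have "(\<lambda>n. x n - (\<Sum>k=0..r. f k n)) \<in> O(f (j r))" for r
    proof -
      \<comment> \<open>All coefficients strictly between \<open>r\<close> and \<open>j r\<close>
        vanish, so order \<open>j r - 1\<close> has the same partial sum as order \<open>r\<close>
        but an error of shift \<open>j r\<close>.\<close>
      have "(\<Sum>k\<le>j r - 1. D $ k * A $ (n - k)) = (\<Sum>k\<le>r. D $ k * A $ (n - k))" for n
      proof (rule sum.mono_neutral_right)
        show "\<forall>k\<in>{..j r - 1} - {..r}. D $ k * A $ (n - k) = 0"
          using gap[of r] j(1)[of r] by auto
      qed (use j(1)[of r] in auto)
      then have "(\<lambda>n. F $ n - (\<Sum>k\<le>r. D $ k * A $ (n - k))) \<in> O(\<lambda>n. A $ (n - j r))"
        using F[of "j r - 1"] j(1)[of r] by (simp add: expands_def)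
      from f_theta[OF j(2) this] show ?thesis
        by (subst landau_o.big.in_cong[OF err])
    qed
    moreover have "f (j k) \<in> o(f k)" if "D $ k \<noteq> 0" for k
    proof -
      have "(\<lambda>n. D $ j k * A $ (n - j k)) \<in> o(\<lambda>n. D $ k * A $ (n - k))"
        using gargantuan_shift_smallo[OF a j(1)[of k]] that j(2)[of k] by simp
      then have "(\<lambda>n. D $ j k * A $ (n - j k) / A $ n) \<in> o(\<lambda>n. D $ k * A $ (n - k) / A $ n)"
        using nz by (intro landau_o.small.divide_right)
      then show ?thesis
        by (simp add: landau_o.small.in_cong[OF f] landau_o.small.cong[OF f])
    qed
    ultimately show ?thesis
      unfolding asymptotic_expansion_def by (simp add: next_j van)
  qed
qed

text \<open>A structure on \<open>X\<close> yields a composite structure with the single block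
  \<open>X\<close> and the same weight, which the isomorphism identifies with a structure of
  \<open>A\<close>.\<close>

lemma positive_weights_of_composite:
  assumes A: "positive_weights A" and iso: "species_iso \<phi> A (compose_species set_species B)"
    and X: "finite X" "X \<noteq> {}" and s: "s \<in> structures B X"
  shows "weight B X s > 0"
proof -
  define c where "c = ({X}, {X}, \<lambda>Y\<in>{X}. s)"
  have "c \<in> structures (compose_species set_species B) X"
    using partition_on_space[OF X(2)] s by (simp add: c_def compose_species_def set_species_def)
  also have "\<dots> = \<phi> X ` structures A X"
    using iso X(1) by (simp add: species_iso_def bij_betw_def)
  finally obtain a where a: "c = \<phi> X a" "a \<in> structures A X"
    by (rule imageE)
  then have "weight (compose_species set_species B) X c = weight A X a"
    using iso X(1) by (simp add: species_iso_def)
  moreover have "weight (compose_species set_species B) X c = weight B X s"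
    by (simp add: c_def compose_species_def set_species_def)
  ultimately show ?thesis
    using A a(2) X(1) by (simp add: positive_weights_def)
qed

lemma bij_betw_vimage:
  assumes "bij_betw f A B" "K \<subseteq> B"
  shows "bij_betw f {s \<in> A. f s \<in> K} K"
proof (rule bij_betw_imageI)
  show "inj_on f {s \<in> A. f s \<in> K}"
    using bij_betw_imp_inj_on[OF assms(1)] by (rule inj_on_subset) blast
  show "f ` {s \<in> A. f s \<in> K} = K"
    using bij_betw_imp_surj_on[OF assms(1)] assms(2) by blast
qed

lemma component_species_subset:
  "structures (component_species B m) U \<subseteq> structures (compose_species set_species B) U"
  "weight (component_species B m) U = weight (compose_species set_species B) U"
  by (auto simp: component_species_def compose_species_def sets_of_card_def restrict_species_def
      set_species_def split: if_splits)

theorem theorem3p1: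
  fixes A :: "(nat, 'a) species" and B :: "(nat, 'b) species"
    and \<phi> :: "nat set \<Rightarrow> 'a \<Rightarrow> nat set set \<times> nat set set \<times> (nat set \<Rightarrow> 'b)"
    and m :: nat
  assumes "is_species A" and "is_species B"
    and "positive_weights A"
    and "structures B {} = {}"
    and "species_iso \<phi> A (compose_species set_species B)"
    and "gargantuan_species A"
  shows "asymptotic_expansion
    (\<lambda>n. measure_pmf.prob (random_structure A {1..n})
       {s \<in> structures A {1..n}. \<phi> {1..n} s \<in> structures (component_species B (int m)) {1..n}})
    0
    (\<lambda>k n. virtual_total_weight (coefficient_species B (int m)) {1..k} * real (n choose k) *
       (total_weight A {1..n - k} / total_weight A {1..n}))"
proof -
  note A = assms(1) and B = assms(2) and pos = assms(3) and B_empty = assms(4) and iso = assms(5)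
  define b where "b = Abs_fps (\<lambda>n. total_weight B {1..n} / fact n)"
  define a where "a = fps_exp 1 oo b"
  define e where "e = fps_exp (-1) oo b"
  define D where "D = log_power_deriv b e m"
  define H where "H = fps_const (1 / fact m) * b ^ m"
  have b0: "b $ 0 = 0"
    using B_empty by (simp add: b_def total_weight_def)
  have B_has_sum: "(weight B X has_sum fact (card X) * b $ card X) (structures B X)"
    if "finite X" for X
    using has_sum_total_weight[OF B that] total_weight_card[OF B that] by (simp add: b_def)
  have bij: "bij_betw (\<phi> U) (structures A U) (structures (compose_species set_species B) U)"
    and weight_iso: "s \<in> structures A U \<Longrightarrow> weight (compose_species set_species B) U (\<phi> U s) = weight A U s"
    if "finite U" for U s
    using iso that unfolding species_iso_def by auto
  have A_total: "total_weight A U = fact (card U) * a $ card U" if U: "finite U" for U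
  proof -
    have "total_weight A U = total_weight (compose_species set_species B) U"
      unfolding total_weight_def infsum_reindex_bij_betw[OF bij[OF U], symmetric]
      using weight_iso[OF U] by (intro infsum_cong) simp
    then show ?thesis
      using total_weight_eqI[OF has_sum_set_compose[OF U b0 B_has_sum]] by (simp add: a_def)
  qed
  have a: "gargantuan (fps_nth a)"
    using assms(6) by (simp add: gargantuan_species_def A_total)
  have nz: "\<forall>\<^sub>F n in sequentially. a $ n \<noteq> 0"
    using a by (simp add: gargantuan_def)
  have b_nonneg: "b $ n \<ge> 0" for n
  proof (cases "n = 0")
    case False
    have "total_weight B {1..n} \<ge> 0"
      unfolding total_weight_def
      using positive_weights_of_composite[OF pos iso, of "{1..n}"] False
      by (intro infsum_nonneg less_imp_le) auto
    then show ?thesis by (simp add: b_def)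
  qed (simp add: b0)
  have b_power_nonneg: "b ^ k $ n \<ge> 0" for k n
    by (induction k arbitrary: n) (auto simp: fps_mult_nth intro!: sum_nonneg mult_nonneg_nonneg b_nonneg)
  \<comment> \<open>\<open>b\<close> is the linear term of \<open>exp b\<close>, and the other terms
    are nonnegative. Positivity thus supplies the bound of \<open>b\<close> by \<open>a\<close> that
    \<open>expands_log\<close> assumes.\<close>
  have b_le_a: "b $ n \<le> a $ n" if "n > 0" for n
  proof -
    have "b $ n = (\<Sum>k\<in>{1}. fps_exp 1 $ k * b ^ k $ n)" by simp
    also have "\<dots> \<le> (\<Sum>k\<in>{0..n}. fps_exp 1 $ k * b ^ k $ n)"
      using that b_power_nonneg by (intro sum_mono2) auto
    finally show ?thesis by (simp add: a_def fps_compose_nth)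
  qed
  have b_bigo: "fps_nth b \<in> O(fps_nth a)"
  proof (intro landau_o.big_mono eventually_sequentiallyI[of 1])
    fix n :: nat assume "1 \<le> n"
    then show "norm (b $ n) \<le> norm (a $ n)"
      using b_le_a[of n] b_nonneg[of n] by simp
  qed
  have a0: "a $ 0 = 1"
    by (simp add: a_def)
  have a_deriv: "fps_deriv a = a * fps_deriv b"
    by (simp add: a_def fps_compose_deriv[OF b0])
  have ae: "a * e = 1"
    unfolding a_def e_def fps_compose_mult_distrib[OF b0, symmetric]
    by (simp flip: fps_exp_add_mult)
  have b_expands: "expands a b e r" for r
    by (rule expands_log[OF a a0 b_bigo a_deriv ae])
  have H_expands: "expands a H D r" for r
    unfolding H_def D_def by (rule expands_log_power[OF a b_expands])
  have comp_total: "total_weight (component_species B (int m)) U = fact (card U) * H $ card U"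
    if "finite U" for U
    unfolding H_def by (rule total_weight_eqI[OF has_sum_component_species[OF that b0 B_has_sum]])
  have coeff: "virtual_total_weight (coefficient_species B (int m)) {1..k} = fact k * D $ k" for k
    using virtual_total_weight_coefficient_species[OF _ b0 B_has_sum, of "{1..k}" m]
    by (simp add: D_def e_def)
  show ?thesis
  proof (rule asymptotic_expansion_of_expands[OF a H_expands])
    \<comment> \<open>For \<open>m = 0\<close> the series \<open>H\<close> is 1 and \<open>D\<close>
      is 0; otherwise \<open>D\<close> has infinite support.\<close>
    show "(\<forall>N. \<exists>k>N. D $ k \<noteq> 0) \<or> D = 0 \<and> (\<forall>\<^sub>F n in sequentially. H $ n = 0)"
    proof (cases "m = 0")
      case True
      have "\<forall>\<^sub>F n in sequentially. H $ n = 0"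
        by (rule eventually_sequentiallyI[of 1]) (simp add: H_def True)
      then show ?thesis by (simp add: D_def log_power_deriv_def True)
    next
      case False
      then show ?thesis
        unfolding D_def using log_power_deriv_infinite_support[OF a b_expands ae b0] by blast
    qed
  next
    \<comment> \<open>Where \<open>a $ n\<close> is zero the weights cannot be normalised; by
      \<open>nz\<close> this concerns only finitely many \<open>n\<close>.\<close>
    have "measure_pmf.prob (random_structure A {1..n})
       {s \<in> structures A {1..n}. \<phi> {1..n} s \<in> structures (component_species B (int m)) {1..n}} =
       H $ n / a $ n" if n: "a $ n \<noteq> 0" for n
    proof -
      let ?U = "{1..n}" and ?K = "component_species B (int m)"
      let ?S = "{s \<in> structures A ?U. \<phi> ?U s \<in> structures ?K ?U}"
      have "bij_betw (\<phi> ?U) ?S (structures ?K ?U)"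
        by (intro bij_betw_vimage[OF bij] component_species_subset(1)) simp
      then have "total_weight ?K ?U = (\<Sum>\<^sub>\<infinity>s\<in>?S. weight ?K ?U (\<phi> ?U s))"
        unfolding total_weight_def by (rule infsum_reindex_bij_betw[symmetric])
      also have "\<dots> = infsum (weight A ?U) ?S"
        using weight_iso[of ?U] by (intro infsum_cong) (simp add: component_species_subset(2))
      finally have "infsum (weight A ?U) ?S = fact n * H $ n"
        using comp_total[of ?U] by simp
      moreover have "total_weight A ?U = fact n * a $ n"
        using A_total[of ?U] by simp
      ultimately show ?thesis
        using n by (subst prob_random_structure[OF A pos]) auto
    qed
    with nz show "\<forall>\<^sub>F n in sequentially. measure_pmf.prob (random_structure A {1..n})
       {s \<in> structures A {1..n}. \<phi> {1..n} s \<in> structures (component_species B (int m)) {1..n}} =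
       H $ n / a $ n"
      by (auto elim: eventually_mono)
  next
    fix k
    \<comment> \<open>The total weights carry \<open>fact k\<close>, \<open>fact (n - k)\<close> and
      \<open>fact n\<close>, which the binomial coefficient cancels.\<close>
    show "\<forall>\<^sub>F n in sequentially. virtual_total_weight (coefficient_species B (int m)) {1..k} *
        real (n choose k) * (total_weight A {1..n - k} / total_weight A {1..n}) =
        D $ k * a $ (n - k) / a $ n"
      using eventually_ge_at_top[of k]
      by eventually_elim (simp add: coeff[simplified] A_total binomial_fact)
  qed
qed

end
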